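(* Let $\vec{p}=(p_1,p_2)$ and $\vec{q}=(q_1,q_2)$ satisfy $1<p_-\le p_+\le q_-\le q_+<\infty$, and let $\vec a,\vec b,\vec c\in\mathbb{R}^2$, $\vec\alpha,\vec\beta\in(-1,\infty)^2$. Then the following are equivalent: (1) $S_{\vec a,\vec b,\vec c}$ is bounded from $L^{\vec p}_{\vec\alpha}(T_B\times T_B)$ to $L^{\vec q}_{\vec\beta}(T_B\times T_B)$; (2) $T_{\vec a,\vec b,\vec c}$ is bounded from $L^{\vec p}_{\vec\alpha}(T_B\times T_B)$ to $L^{\vec q}_{\vec\beta}(T_B\times T_B)$; (3) for each $i\in\{1,2\}$: $-q_ia_i<\beta_i+1$, $\alpha_i+1<p_i(b_i+1)$, and $c_i=n+1+a_i+b_i+\lambda_i$, where $\lambda_i=\frac{n+1+\beta_i}{q_i}-\frac{n+1+\alpha_i}{p_i}$.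
   Context: Let $n$ be a positive integer. For $z=(z_1,\dots,z_n)\in\mathbb{C}^n$ write $z=x+iy$ with $x,y\in\mathbb{R}^n$, $z'=(z_1,\dots,z_{n-1})$, $y'=(y_1,\dots,y_{n-1})$. Let $B=\{y\in\mathbb{R}^n: |y'|^2<y_n\}$ and $T_B=\{x+iy: x\in\mathbb{R}^n, y\in B\}$. For $z\in T_B$ put $\rho(z)=y_n-|y'|^2>0$, and for $z,u\in T_B$ put $\rho(z,u)=\frac14\big(\sum_{j=1}^{n-1}(z_j-\overline{u_j})^2-2i(z_n-\overline{u_n})\big)$; this has positive real part, and complex powers $\rho(z,u)^c$ are taken with the principal branch. $dV$ is Lebesgue measure on $\mathbb{C}^n$ and $dV_\alpha(z)=\rho(z)^\alpha dV(z)$. For $\vec p=(p_1,p_2)\in[1,\infty]^2$ and $\vec\alpha=(\alpha_1,\alpha_2)$, $L^{\vec p}_{\vec\alpha}(T_B\times T_B)$ is the space of measurable $f$ on $T_B\times T_B$ with finite mixed norm $\|f\|_{\vec p,\vec\alpha}=\big\{\int_{T_B}\big(\int_{T_B}|f(z,w)|^{p_1}dV_{\alpha_1}(z)\big)^{p_2/p_1}dV_{\alpha_2}(w)\big\}^{1/p_2}$, with the inner (resp. outer) integral replaced by an essential supremum in $z$ (resp. $w$) when $p_1=\infty$ (resp. $p_2=\infty$); when $\vec p=(\infty,\infty)$ this is $L^\infty(T_B\times T_B)$. Write $p_-=\min\{p_1,p_2\}$, $p_+=\max\{p_1,p_2\}$, and similarly $q_\pm$. For $\vec a=(a_1,a_2),\vec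 b=(b_1,b_2),\vec c=(c_1,c_2)\in\mathbb{R}^2$, $T_{\vec a,\vec b,\vec c}f(z,w)=\rho(z)^{a_1}\rho(w)^{a_2}\int_{T_B}\int_{T_B}\frac{\rho(u)^{b_1}\rho(\eta)^{b_2}}{\rho(z,u)^{c_1}\rho(w,\eta)^{c_2}}f(u,\eta)\,dV(u)\,dV(\eta)$ and $S_{\vec a,\vec b,\vec c}f(z,w)=\rho(z)^{a_1}\rho(w)^{a_2}\int_{T_B}\int_{T_B}\frac{\rho(u)^{b_1}\rho(\eta)^{b_2}}{|\rho(z,u)|^{c_1}|\rho(w,\eta)|^{c_2}}f(u,\eta)\,dV(u)\,dV(\eta)$. An operator is bounded from $X$ to $Y$ if for every $f\in X$ the defining integral converges for a.e. $(z,w)$ and $\|Tf\|_Y\le C\|f\|_X$ with $C$ independent of $f$. *)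

theory Defs
  imports "HOL-Analysis.Analysis"
begin

text \<open>Points of C^n are elements of complex^'n, n = CARD('n); the fixed index e plays
  the role of the last coordinate z_n, the other indices give z'.\<close>

definition tb_rho :: "'n::finite \<Rightarrow> complex^'n \<Rightarrow> real" where
  "tb_rho e z = Im (z$e) - (\<Sum>j\<in>UNIV-{e}. (Im (z$j))^2)"

definition TB :: "'n::finite \<Rightarrow> (complex^'n) set" where
  "TB e = {z. tb_rho e z > 0}"

definition tb_rho2 :: "'n::finite \<Rightarrow> complex^'n \<Rightarrow> complex^'n \<Rightarrow> complex" where
  "tb_rho2 e z u = (1/4) * ((\<Sum>j\<in>UNIV-{e}. (z$j - cnj (u$j))^2) - 2 * \<i> * (z$e - cnj (u$e)))"

text \<open>Real power on extended nonnegative reals (used with positive exponents only).\<close>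
definition ennpow :: "ennreal \<Rightarrow> real \<Rightarrow> ennreal" where
  "ennpow x r = (if x = \<infinity> then \<infinity> else ennreal (enn2real x powr r))"

definition mixnorm :: "'n::finite \<Rightarrow> real \<times> real \<Rightarrow> real \<times> real
     \<Rightarrow> ((complex^'n) \<times> (complex^'n) \<Rightarrow> complex) \<Rightarrow> ennreal" where
  "mixnorm e p al f =
     ennpow (\<integral>\<^sup>+ w. indicator (TB e) w *
        ennpow (\<integral>\<^sup>+ z. indicator (TB e) z *
                   ennreal (cmod (f (z, w)) powr fst p * tb_rho e z powr fst al) \<partial>lborel)
               (snd p / fst p)
        * ennreal (tb_rho e w powr snd al) \<partial>lborel) (1 / snd p)"

text \<open>Integral operator with kernel K (the weights rho(z)^a rho(w)^a rho(u)^b rho(eta)^b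
  are included in K).\<close>
definition kop :: "'n::finite \<Rightarrow> ((complex^'n) \<times> (complex^'n) \<Rightarrow> (complex^'n) \<times> (complex^'n) \<Rightarrow> complex)
     \<Rightarrow> ((complex^'n) \<times> (complex^'n) \<Rightarrow> complex) \<Rightarrow> (complex^'n) \<times> (complex^'n) \<Rightarrow> complex" where
  "kop e K f x = (LINT y : TB e \<times> TB e | lborel \<Otimes>\<^sub>M lborel. K x y * f y)"

definition bounded_kop :: "'n::finite \<Rightarrow> ((complex^'n) \<times> (complex^'n) \<Rightarrow> (complex^'n) \<times> (complex^'n) \<Rightarrow> complex)
     \<Rightarrow> real \<times> real \<Rightarrow> real \<times> real \<Rightarrow> real \<times> real \<Rightarrow> real \<times> real \<Rightarrow> bool" where
  "bounded_kop e K p al q be \<longleftrightarrow>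
     (\<exists>C::real. \<forall>f. f \<in> borel_measurable (lborel \<Otimes>\<^sub>M lborel) \<longrightarrow> mixnorm e p al f < \<infinity> \<longrightarrow>
        (AE x in lborel \<Otimes>\<^sub>M lborel. x \<in> TB e \<times> TB e \<longrightarrow>
            set_integrable (lborel \<Otimes>\<^sub>M lborel) (TB e \<times> TB e) (\<lambda>y. K x y * f y))
        \<and> mixnorm e q be (kop e K f) \<le> ennreal C * mixnorm e p al f)"

definition kernT :: "'n::finite \<Rightarrow> real \<times> real \<Rightarrow> real \<times> real \<Rightarrow> real \<times> real
     \<Rightarrow> (complex^'n) \<times> (complex^'n) \<Rightarrow> (complex^'n) \<times> (complex^'n) \<Rightarrow> complex" where
  "kernT e a b c = (\<lambda>(z, w) (u, \<eta>).
     complex_of_real (tb_rho e z powr fst a * tb_rho e w powr snd a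
                      * tb_rho e u powr fst b * tb_rho e \<eta> powr snd b)
     / (tb_rho2 e z u powr complex_of_real (fst c) * tb_rho2 e w \<eta> powr complex_of_real (snd c)))"

definition kernS :: "'n::finite \<Rightarrow> real \<times> real \<Rightarrow> real \<times> real \<Rightarrow> real \<times> real
     \<Rightarrow> (complex^'n) \<times> (complex^'n) \<Rightarrow> (complex^'n) \<times> (complex^'n) \<Rightarrow> complex" where
  "kernS e a b c = (\<lambda>(z, w) (u, \<eta>).
     complex_of_real (tb_rho e z powr fst a * tb_rho e w powr snd a
                      * tb_rho e u powr fst b * tb_rho e \<eta> powr snd b
     / (cmod (tb_rho2 e z u) powr fst c * cmod (tb_rho2 e w \<eta>) powr snd c)))"

end

theory Submission
  imports Defs
begin

text \<open>
  Since \<open>|\<rho>(z,u)\<^sup>c| = |\<rho>(z,u)|\<^sup>c\<close> for real \<open>c\<close>, boundedness of \<open>S\<close> implies that of \<open>T\<close>.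

  Sufficiency: the kernel of \<open>S\<close> is a product, so Minkowski's integral inequality reduces the mixed norm
  estimate to the two one-variable operators. These are handled by a Schur test for \<open>p \<le> q\<close> with powers of
  \<open>\<rho>\<close> as test functions; its hypotheses are instances of the Forelli--Rudin estimate, which follows from
  a dyadic decomposition in \<open>|\<rho>(z,u)|\<close> after the volume preserving shear \<open>u\<^sub>n \<mapsto> u\<^sub>n + m(u')\<close>
  that turns \<open>\<rho>(u)\<close> into \<open>Im u\<^sub>n\<close>.

  Necessity: on \<open>f(u,\<eta>) = g(u) h(\<eta>)\<close> the operator \<open>T\<close> factorises, so each variable can be tested
  separately. On small sets at scale \<open>R\<close> near the boundary point \<open>0\<close> and near \<open>R i e\<^sub>n\<close> one has
  \<open>\<rho>(z,u) \<approx> R/2\<close>, so the kernel has almost constant phase and \<open>T\<close> is bounded below there.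
  Letting \<open>R\<close> vary gives the formula for \<open>c\<close>, letting \<open>z\<close> approach the boundary gives the condition on
  \<open>a\<close>, and \<open>g = \<rho>\<^bsup>-(b+1)\<^esup>\<close> truncated to \<open>\<tau> \<le> \<rho> \<le> \<epsilon>\<close> with \<open>\<tau> \<rightarrow> 0\<close> gives the condition on \<open>b\<close>.
\<close>

section \<open>Integral inequalities\<close>

text \<open>Scaling dictates every exponent. A box of size sqrt R in the 2n-2 real coordinates of z'
  and of size R in Re z_n and in rho has measure proportional to R^(n+1), and the set where
  |rho(z,u)| <= R fits into such a box. This is the origin of n+1 in (3). The two inequalities in
  (3) say that the intervals from which the exponents of the Schur test functions are taken are
  nonempty. They are strict because at the critical exponent the integral of a power of rho over
  heights between l and a constant is a logarithm, unbounded as l tends to 0. For the condition on b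
  this logarithm enters to the power 1 on one side and at most to the power 1/p on the other, so p >
  1 decides. Positive integrals are kept in \<open>ennreal\<close>, where Tonelli holds without
  integrability; convergence almost everywhere is read off afterwards from the finiteness of a norm.
  The obstacle in the necessity part is that T has an oscillating kernel, so it cannot be compared
  with S from below. The test sets must keep rho(z,u)/R in a disc whose radius is the same for all
  R, so that letting R vary is legitimate.\<close>

lemma ennpow_top [simp]: "ennpow top r = top"
  by (simp add: ennpow_def)

lemma ennpow_ennreal: "0 \<le> x \<Longrightarrow> ennpow (ennreal x) r = ennreal (x powr r)"
  by (simp add: ennpow_def)

lemma ennpow_zero [simp]: "ennpow 0 r = 0"
  by (simp add: ennpow_def)

lemma ennpow_one [simp]: "ennpow x 1 = x"
  by (cases x) (auto simp: ennpow_ennreal)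

lemma ennpow_one_left [simp]: "ennpow 1 r = 1"
  using ennpow_ennreal[of 1 r] by simp

lemma ennpow_eq_top_iff [simp]: "ennpow x r = top \<longleftrightarrow> x = top"
  by (simp add: ennpow_def)

lemma ennpow_eq_0_iff [simp]: "ennpow x r = 0 \<longleftrightarrow> x = 0"
  by (cases x) (auto simp: ennpow_ennreal)

lemma ennpow_less_top_iff [simp]: "ennpow x r < top \<longleftrightarrow> x < top"
  by (simp add: less_top[symmetric])

lemma ennpow_mono: "x \<le> y \<Longrightarrow> 0 \<le> r \<Longrightarrow> ennpow x r \<le> ennpow y r"
  by (cases x; cases y) (auto simp: ennpow_ennreal top_unique intro!: ennreal_leI powr_mono2)

text \<open>The conventions \<open>0 powr r = 0\<close> and \<open>ennpow top r = top\<close>, kept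
  for every sign of r, together with \<open>0 * top = 0\<close>, make this law and the next two hold
  without side conditions. Exponents can then be rearranged freely in infinite or vanishing
  integrals.\<close>

lemma ennpow_mult: "ennpow (x * y) r = ennpow x r * ennpow y r"
  by (cases x; cases y)
     (auto simp: ennpow_ennreal ennreal_mult[symmetric] powr_mult ennreal_mult_top ennreal_top_mult)

lemma ennpow_ennpow: "ennpow (ennpow x r) s = ennpow x (r * s)"
  by (cases x) (auto simp: ennpow_ennreal powr_powr)

lemma ennpow_add: "ennpow x (r + s) = ennpow x r * ennpow x s"
  by (cases x) (auto simp: ennpow_ennreal powr_add ennreal_mult)

lemma borel_measurable_ennpow [measurable]:
  assumes [measurable]: "f \<in> borel_measurable M"
  shows "(\<lambda>x. ennpow (f x) r) \<in> borel_measurable M"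
  unfolding ennpow_def by measurable

text \<open>Removes an auxiliary positive function from the proof of Minkowski's inequality by
  letting its coefficient d tend to 0.\<close>

lemma ennreal_le_of_forall_pos_mult:
  assumes "\<And>d::real. 0 < d \<Longrightarrow> x \<le> a + ennreal d * b" "b < top"
  shows "x \<le> a"
proof (cases b)
  case (real b')
  show ?thesis
  proof (rule ennreal_le_epsilon)
    fix e :: real assume e: "0 < e"
    have "x \<le> a + ennreal (e / (b' + 1)) * b"
      using assms(1)[of "e / (b' + 1)"] e real by simp
    also have "ennreal (e / (b' + 1)) * b = ennreal (e / (b' + 1) * b')"
      using e real by (subst ennreal_mult) auto
    also have "\<dots> \<le> ennreal e"
      using e real by (intro ennreal_leI) (simp add: field_simps)
    finally show "x \<le> a + ennreal e" by (simp add: add_left_mono)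
  qed
qed (use assms in auto)

text \<open>Young's inequality for f / A^(1/p) and g / B^(1/q) at each point, then integration. The
  cases in which A or B is 0 or infinite are split off first, since this normalisation is
  meaningless there.\<close>

lemma nn_integral_Hoelder:
  assumes [measurable]: "f \<in> borel_measurable M" "g \<in> borel_measurable M"
    and pq: "1 < p" "1 < q" "1 / p + 1 / q = 1"
  shows "(\<integral>\<^sup>+x. f x * g x \<partial>M)
     \<le> ennpow (\<integral>\<^sup>+x. ennpow (f x) p \<partial>M) (1 / p) * ennpow (\<integral>\<^sup>+x. ennpow (g x) q \<partial>M) (1 / q)"
proof -
  define A where "A = (\<integral>\<^sup>+x. ennpow (f x) p \<partial>M)"
  define B where "B = (\<integral>\<^sup>+x. ennpow (g x) q \<partial>M)"
  show ?thesis
  proof (cases "A = 0 \<or> B = 0")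
    case True
    then have "(AE x in M. f x = 0) \<or> (AE x in M. g x = 0)"
      by (auto simp: A_def B_def nn_integral_0_iff_AE)
    then have "AE x in M. f x * g x = 0"
      by (auto elim!: AE_mp intro: AE_I2)
    then have "(\<integral>\<^sup>+x. f x * g x \<partial>M) = 0" by (simp add: nn_integral_0_iff_AE)
    then show ?thesis by simp
  next
    case nz: False
    show ?thesis
    proof (cases "A = top \<or> B = top")
      case True
      then have "ennpow A (1/p) * ennpow B (1/q) = top"
        using nz by (auto simp: ennreal_mult_eq_top_iff)
      then show ?thesis by (simp add: A_def B_def)
    next
      case False
      then obtain \<alpha> \<beta> where ab: "A = ennreal \<alpha>" "B = ennreal \<beta>" "0 < \<alpha>" "0 < \<beta>"
        using nz by (cases A; cases B) (auto simp: order_less_le)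
      \<comment> \<open>Chosen so that \<open>c1 * \<alpha>\<close> and \<open>c2 * \<beta>\<close>
        are 1/p and 1/q times the right-hand side; the two shares add up to all of it.\<close>
      define c1 where "c1 = \<alpha> powr (1/p) * \<beta> powr (1/q) / (p * \<alpha>)"
      define c2 where "c2 = \<alpha> powr (1/p) * \<beta> powr (1/q) / (q * \<beta>)"
      have c: "0 < c1" "0 < c2" using ab pq by (auto simp: c1_def c2_def)
      have young: "f x * g x \<le> ennreal c1 * ennpow (f x) p + ennreal c2 * ennpow (g x) q" for x
      proof (cases "f x = top \<or> g x = top")
        case True
        then have "ennreal c1 * ennpow (f x) p + ennreal c2 * ennpow (g x) q = top"
          using c by (auto simp: ennreal_mult_top)
        then show ?thesis by (simp only: top_greatest)
      next
        case False
        then obtain s t where st: "f x = ennreal s" "g x = ennreal t" "0 \<le> s" "0 \<le> t"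
          by (cases "f x"; cases "g x") auto
        have "(s / \<alpha> powr (1/p)) * (t / \<beta> powr (1/q))
          \<le> (s / \<alpha> powr (1/p)) powr p / p + (t / \<beta> powr (1/q)) powr q / q"
          using pq st by (intro Youngs_inequality) auto
        also have "\<dots> = s powr p / (p * \<alpha>) + t powr q / (q * \<beta>)"
          using pq st ab by (simp add: powr_divide powr_powr mult.commute)
        finally have "s * t \<le> (\<alpha> powr (1/p) * \<beta> powr (1/q)) * (s powr p / (p * \<alpha>) + t powr q / (q * \<beta>))"
          using ab by (simp add: field_simps)
        also have "\<dots> = c1 * s powr p + c2 * t powr q"
          by (simp add: c1_def c2_def algebra_simps)
        finally show ?thesis
          using c st by (simp add: ennpow_ennreal ennreal_mult[symmetric] ennreal_plus[symmetric] ennreal_leI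
              del: ennreal_plus)
      qed
      have "(\<integral>\<^sup>+x. f x * g x \<partial>M) \<le> (\<integral>\<^sup>+x. ennreal c1 * ennpow (f x) p + ennreal c2 * ennpow (g x) q \<partial>M)"
        by (intro nn_integral_mono young)
      also have "\<dots> = ennreal c1 * A + ennreal c2 * B"
        by (simp add: nn_integral_add nn_integral_cmult A_def B_def)
      also have "\<dots> = ennreal (c1 * \<alpha> + c2 * \<beta>)"
        using c ab by (simp add: ennreal_mult)
      also have "c1 * \<alpha> + c2 * \<beta> = \<alpha> powr (1/p) * \<beta> powr (1/q) * (1/p + 1/q)"
        using ab pq by (simp add: c1_def c2_def field_simps)
      also have "ennreal \<dots> = ennpow A (1/p) * ennpow B (1/q)"
        using ab pq by (simp add: ennpow_ennreal ennreal_mult)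
      finally show ?thesis by (simp add: A_def B_def)
    qed
  qed
qed

text \<open>Duality is replaced by Hoelder's inequality in y with a weight built from h(y), the L^q
  norm of F(., y): F is split as (F h^(-1/r)) h^(1/r) with 1/q + 1/r = 1. After the interchange of
  integrals the first factor contributes h^(q - q/r) = h, so no power of the possibly infinite
  left-hand side has to be divided out.\<close>

lemma nn_integral_Minkowski:
  assumes "sigma_finite_measure M" "sigma_finite_measure N"
    and F [measurable]: "(\<lambda>(x, y). F x y) \<in> borel_measurable (M \<Otimes>\<^sub>M N)" and q: "1 \<le> q"
  shows "ennpow (\<integral>\<^sup>+x. ennpow (\<integral>\<^sup>+y. F x y \<partial>N) q \<partial>M) (1 / q)
     \<le> (\<integral>\<^sup>+y. ennpow (\<integral>\<^sup>+x. ennpow (F x y) q \<partial>M) (1 / q) \<partial>N)"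
proof -
  interpret M: sigma_finite_measure M by fact
  interpret N: sigma_finite_measure N by fact
  interpret MN: pair_sigma_finite M N ..
  have Fs [measurable]: "(\<lambda>(y, x). F x y) \<in> borel_measurable (N \<Otimes>\<^sub>M M)"
    using measurable_pair_swap[OF F] by (simp add: split_beta')
  show ?thesis
  proof (cases "q = 1")
    case True
    then show ?thesis using MN.Fubini'[OF F] by simp
  next
    case False
    with q have q1: "1 < q" by simp
    define r where "r = q / (q - 1)"
    have r: "1 < r" "1 / q + 1 / r = 1" using q1 by (auto simp: r_def field_simps)
    define h where "h y = ennpow (\<integral>\<^sup>+x. ennpow (F x y) q \<partial>M) (1 / q)" for y
    have [measurable]: "h \<in> borel_measurable N" unfolding h_def by measurable
    \<comment> \<open>By sigma-finiteness there is a strictly positive function with finite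
      integral. The weight h may vanish; h + d k does not, and d tends to 0 at the end.\<close>
    obtain k where k [measurable]: "k \<in> borel_measurable N" and kfin: "integral\<^sup>N N k \<noteq> \<infinity>"
      and kpos: "\<And>y. y \<in> space N \<Longrightarrow> 0 < k y \<and> k y < \<infinity>"
      using N.Ex_finite_integrable_function by auto
    show ?thesis
    proof (cases "integral\<^sup>N N h = top")
      case True
      then show ?thesis by (simp add: h_def[abs_def])
    next
      case hfin: False
      have hAE: "AE y in N. h y \<noteq> top"
        using hfin nn_integral_noteq_infinite[of h N] by auto
      have "ennpow (\<integral>\<^sup>+x. ennpow (\<integral>\<^sup>+y. F x y \<partial>N) q \<partial>M) (1 / q)
         \<le> integral\<^sup>N N h + ennreal d * integral\<^sup>N N k" if d: "0 < d" for d
      proof -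
        define g where "g y = h y + ennreal d * k y" for y
        have [measurable]: "g \<in> borel_measurable N" unfolding g_def by measurable
        define G where "G = integral\<^sup>N N g"
        have G: "G = integral\<^sup>N N h + ennreal d * integral\<^sup>N N k"
          by (simp add: G_def g_def[abs_def] nn_integral_add nn_integral_cmult)
        have gpos: "AE y in N. 0 < g y \<and> g y < top \<and> h y \<le> g y"
          using hAE AE_space
        proof eventually_elim
          case (elim y)
          with kpos[OF elim(2)] d show ?case
            by (auto simp: g_def less_top[symmetric] ennreal_mult_eq_top_iff zero_less_iff_neq_zero)
        qed
        define gi where "gi y = ennpow (inverse (g y)) (1 / r)" for y
        have [measurable]: "gi \<in> borel_measurable N" unfolding gi_def by measurable
        have gi: "AE y in N. gi y * ennpow (g y) (1 / r) = 1"
          using gpos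
        proof eventually_elim
          case (elim y)
          then have "g y / g y = 1" by (intro ennreal_divide_self) auto
          then have "inverse (g y) * g y = 1" by (simp add: divide_ennreal_def mult.commute)
          then show ?case unfolding gi_def ennpow_mult[symmetric] by simp
        qed
        have bound: "ennpow (\<integral>\<^sup>+y. F x y \<partial>N) q
           \<le> (\<integral>\<^sup>+y. ennpow (F x y * gi y) q \<partial>N) * ennpow G (q / r)" if [simp]: "x \<in> space M" for x
        proof -
          have [measurable]: "(\<lambda>y. F x y) \<in> borel_measurable N"
            using measurable_compose[OF measurable_Pair1'[OF that] F] by simp
          have "(\<integral>\<^sup>+y. F x y \<partial>N) = (\<integral>\<^sup>+y. (F x y * gi y) * ennpow (g y) (1 / r) \<partial>N)"
            using gi by (intro nn_integral_cong_AE) (auto elim!: eventually_mono simp: mult.assoc)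
          also have "\<dots> \<le> ennpow (\<integral>\<^sup>+y. ennpow (F x y * gi y) q \<partial>N) (1 / q)
              * ennpow (\<integral>\<^sup>+y. ennpow (ennpow (g y) (1 / r)) r \<partial>N) (1 / r)"
            using q1 r by (intro nn_integral_Hoelder) auto
          also have "(\<integral>\<^sup>+y. ennpow (ennpow (g y) (1 / r)) r \<partial>N) = G"
            using r by (simp add: ennpow_ennpow G_def)
          finally have "ennpow (\<integral>\<^sup>+y. F x y \<partial>N) q \<le> ennpow (ennpow (\<integral>\<^sup>+y. ennpow (F x y * gi y) q \<partial>N) (1 / q) * ennpow G (1 / r)) q"
            using q1 by (intro ennpow_mono) auto
          then show ?thesis
            using q1 by (simp add: ennpow_mult ennpow_ennpow)
        qed
        have "(\<integral>\<^sup>+x. ennpow (\<integral>\<^sup>+y. F x y \<partial>N) q \<partial>M)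
          \<le> (\<integral>\<^sup>+x. (\<integral>\<^sup>+y. ennpow (F x y * gi y) q \<partial>N) * ennpow G (q / r) \<partial>M)"
          by (intro nn_integral_mono bound)
        also have "\<dots> = (\<integral>\<^sup>+x. (\<integral>\<^sup>+y. ennpow (F x y * gi y) q \<partial>N) \<partial>M) * ennpow G (q / r)"
          by (intro nn_integral_multc) measurable
        also have "(\<integral>\<^sup>+x. (\<integral>\<^sup>+y. ennpow (F x y * gi y) q \<partial>N) \<partial>M)
            = (\<integral>\<^sup>+y. (\<integral>\<^sup>+x. ennpow (F x y * gi y) q \<partial>M) \<partial>N)"
          by (intro MN.Fubini'[symmetric]) measurable
        also have "\<dots> = (\<integral>\<^sup>+y. ennpow (h y * gi y) q \<partial>N)"
        proof (intro nn_integral_cong)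
          fix y assume "y \<in> space N"
          then have [measurable]: "(\<lambda>x. F x y) \<in> borel_measurable M"
            using measurable_compose[OF measurable_Pair1'[of y N M] Fs] by simp
          show "(\<integral>\<^sup>+x. ennpow (F x y * gi y) q \<partial>M) = ennpow (h y * gi y) q"
            using q1 by (simp add: ennpow_mult nn_integral_multc h_def ennpow_ennpow)
        qed
        also have "\<dots> \<le> (\<integral>\<^sup>+y. g y \<partial>N)"
        proof (intro nn_integral_mono_AE)
          show "AE y in N. ennpow (h y * gi y) q \<le> g y"
            using gpos gi
          proof eventually_elim
            case (elim y)
            have "ennpow (h y * gi y) q \<le> ennpow (g y * gi y) q"
              using elim q1 by (intro ennpow_mono mult_right_mono) auto
            also have "g y * gi y = (ennpow (g y) (1/q) * ennpow (g y) (1/r)) * gi y"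
              unfolding ennpow_add[symmetric] using r by simp
            also have "\<dots> = ennpow (g y) (1/q) * (gi y * ennpow (g y) (1/r))"
              by (simp only: mult_ac)
            also have "ennpow \<dots> q = g y" using elim q1 by (simp add: ennpow_ennpow)
            finally show ?case .
          qed
        qed
        finally have "(\<integral>\<^sup>+x. ennpow (\<integral>\<^sup>+y. F x y \<partial>N) q \<partial>M) \<le> G * ennpow G (q / r)"
          by (simp add: G_def mult_right_mono)
        also have "\<dots> = ennpow G (1 + q / r)" by (simp add: ennpow_add)
        also have "1 + q / r = q" using r q1 by (simp add: field_simps)
        finally have "ennpow (\<integral>\<^sup>+x. ennpow (\<integral>\<^sup>+y. F x y \<partial>N) q \<partial>M) (1 / q) \<le> ennpow (ennpow G q) (1 / q)"
          using q1 by (intro ennpow_mono) auto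
        then show ?thesis using q1 G by (simp add: ennpow_ennpow)
      qed
      then show ?thesis
        using kfin ennreal_le_of_forall_pos_mult[of _ "integral\<^sup>N N h" "integral\<^sup>N N k"]
        unfolding h_def[abs_def] infinity_ennreal_def top.not_eq_extremum by blast
    qed
  qed
qed

text \<open>Hoelder's inequality in u against k1 leaves h(z), which is attached to k2. Since q / p
  >= 1, Minkowski's inequality then moves the z-integration inside the u-integration, where the
  second hypothesis bounds it uniformly in u. This interchange is what raises the exponent from p to
  q.\<close>

lemma Schur_test:
  assumes "sigma_finite_measure M" "sigma_finite_measure N"
    and [measurable]: "(\<lambda>(z, u). k1 z u) \<in> borel_measurable (M \<Otimes>\<^sub>M N)"
      "(\<lambda>(z, u). k2 z u) \<in> borel_measurable (M \<Otimes>\<^sub>M N)"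
      "h \<in> borel_measurable M" "f \<in> borel_measurable N"
    and pq: "1 < p" "p \<le> q" "1 / p + 1 / p' = 1"
    and k1: "\<And>z. z \<in> space M \<Longrightarrow> (\<integral>\<^sup>+u. ennpow (k1 z u) p' \<partial>N) \<le> A * ennpow (h z) p'"
    and k2: "\<And>u. u \<in> space N \<Longrightarrow> (\<integral>\<^sup>+z. ennpow (h z * k2 z u) q \<partial>M) \<le> B"
  shows "ennpow (\<integral>\<^sup>+z. ennpow (\<integral>\<^sup>+u. k1 z u * k2 z u * f u \<partial>N) q \<partial>M) (1 / q)
    \<le> ennpow A (1 / p') * ennpow B (1 / q) * ennpow (\<integral>\<^sup>+u. ennpow (f u) p \<partial>N) (1 / p)"
proof -
  interpret M: sigma_finite_measure M by fact
  interpret N: sigma_finite_measure N by fact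
  have p': "1 < p'"
  proof -
    have "1 / p < 1" using pq by simp
    then have "0 < 1 / p'" using pq by linarith
    moreover have "1 / p' < 1" using pq by (smt (verit) zero_less_divide_1_iff)
    ultimately show ?thesis by (simp add: divide_less_eq split: if_splits)
  qed
  have pos: "0 < p" "0 < q" using pq by auto
  have pw: "ennpow (\<integral>\<^sup>+u. k1 z u * k2 z u * f u \<partial>N) q
     \<le> ennpow A (q / p') * ennpow (\<integral>\<^sup>+u. ennpow (h z * k2 z u * f u) p \<partial>N) (q / p)"
    if [simp]: "z \<in> space M" for z
  proof -
    have [measurable]: "(\<lambda>u. k1 z u) \<in> borel_measurable N" "(\<lambda>u. k2 z u) \<in> borel_measurable N"
      using measurable_compose[OF measurable_Pair1'[OF that] assms(3)]
        measurable_compose[OF measurable_Pair1'[OF that] assms(4)] by simp_all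
    have "(\<integral>\<^sup>+u. k1 z u * k2 z u * f u \<partial>N) = (\<integral>\<^sup>+u. k1 z u * (k2 z u * f u) \<partial>N)"
      by (simp add: mult.assoc)
    also have "\<dots> \<le> ennpow (\<integral>\<^sup>+u. ennpow (k1 z u) p' \<partial>N) (1 / p')
        * ennpow (\<integral>\<^sup>+u. ennpow (k2 z u * f u) p \<partial>N) (1 / p)"
      using pq p' by (intro nn_integral_Hoelder) (auto simp: add.commute)
    also have "\<dots> \<le> ennpow (A * ennpow (h z) p') (1 / p')
        * ennpow (\<integral>\<^sup>+u. ennpow (k2 z u * f u) p \<partial>N) (1 / p)"
      using p' k1[OF that] by (intro mult_right_mono ennpow_mono) auto
    also have "\<dots> = ennpow A (1 / p') * ennpow (ennpow (h z) p * (\<integral>\<^sup>+u. ennpow (k2 z u * f u) p \<partial>N)) (1 / p)"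
      using p' pos by (simp add: ennpow_mult ennpow_ennpow mult.assoc)
    also have "ennpow (h z) p * (\<integral>\<^sup>+u. ennpow (k2 z u * f u) p \<partial>N) = (\<integral>\<^sup>+u. ennpow (h z * k2 z u * f u) p \<partial>N)"
      by (simp add: ennpow_mult nn_integral_cmult mult.assoc)
    finally have "ennpow (\<integral>\<^sup>+u. k1 z u * k2 z u * f u \<partial>N) q
        \<le> ennpow (ennpow A (1 / p') * ennpow (\<integral>\<^sup>+u. ennpow (h z * k2 z u * f u) p \<partial>N) (1 / p)) q"
      using pos by (intro ennpow_mono) auto
    then show ?thesis by (simp add: ennpow_mult ennpow_ennpow)
  qed
  have "(\<integral>\<^sup>+z. ennpow (\<integral>\<^sup>+u. k1 z u * k2 z u * f u \<partial>N) q \<partial>M)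
      \<le> (\<integral>\<^sup>+z. ennpow A (q / p') * ennpow (\<integral>\<^sup>+u. ennpow (h z * k2 z u * f u) p \<partial>N) (q / p) \<partial>M)"
    by (intro nn_integral_mono pw)
  also have "\<dots> = ennpow A (q / p') * (\<integral>\<^sup>+z. ennpow (\<integral>\<^sup>+u. ennpow (h z * k2 z u * f u) p \<partial>N) (q / p) \<partial>M)"
    by (intro nn_integral_cmult) measurable
  finally have "ennpow (\<integral>\<^sup>+z. ennpow (\<integral>\<^sup>+u. k1 z u * k2 z u * f u \<partial>N) q \<partial>M) (1 / q)
     \<le> ennpow (ennpow A (q / p') * (\<integral>\<^sup>+z. ennpow (\<integral>\<^sup>+u. ennpow (h z * k2 z u * f u) p \<partial>N) (q / p) \<partial>M)) (1 / q)"
    using pos by (intro ennpow_mono) auto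
  also have "\<dots> = ennpow A (1 / p') * ennpow (ennpow (\<integral>\<^sup>+z. ennpow (\<integral>\<^sup>+u. ennpow (h z * k2 z u * f u) p \<partial>N) (q / p) \<partial>M) (1 / (q / p))) (1 / p)"
    using pos by (simp add: ennpow_mult ennpow_ennpow)
  also have "\<dots> \<le> ennpow A (1 / p') * ennpow (\<integral>\<^sup>+u. ennpow (\<integral>\<^sup>+z. ennpow (ennpow (h z * k2 z u * f u) p) (q / p) \<partial>M) (1 / (q / p)) \<partial>N) (1 / p)"
    using pos pq by (intro mult_left_mono ennpow_mono nn_integral_Minkowski assms(1,2)) auto
  also have "\<dots> \<le> ennpow A (1 / p') * ennpow (\<integral>\<^sup>+u. ennpow B (p / q) * ennpow (f u) p \<partial>N) (1 / p)"
  proof (intro mult_left_mono ennpow_mono nn_integral_mono)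
    fix u assume u: "u \<in> space N"
    have [measurable]: "(\<lambda>z. k2 z u) \<in> borel_measurable M"
      using measurable_compose[OF measurable_Pair2'[OF u] assms(4)] by simp
    have "(\<integral>\<^sup>+z. ennpow (ennpow (h z * k2 z u * f u) p) (q / p) \<partial>M)
        = (\<integral>\<^sup>+z. ennpow (h z * k2 z u) q \<partial>M) * ennpow (f u) q"
      using pos by (simp add: ennpow_ennpow ennpow_mult nn_integral_multc)
    also have "\<dots> \<le> B * ennpow (f u) q"
      by (intro mult_right_mono k2 u) auto
    finally have "ennpow (\<integral>\<^sup>+z. ennpow (ennpow (h z * k2 z u * f u) p) (q / p) \<partial>M) (1 / (q / p))
        \<le> ennpow (B * ennpow (f u) q) (1 / (q / p))"
      using pos by (intro ennpow_mono) auto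
    then show "ennpow (\<integral>\<^sup>+z. ennpow (ennpow (h z * k2 z u * f u) p) (q / p) \<partial>M) (1 / (q / p))
        \<le> ennpow B (p / q) * ennpow (f u) p"
      using pos by (simp add: ennpow_mult ennpow_ennpow)
  qed (use pos in auto)
  also have "(\<integral>\<^sup>+u. ennpow B (p / q) * ennpow (f u) p \<partial>N) = ennpow B (p / q) * (\<integral>\<^sup>+u. ennpow (f u) p \<partial>N)"
    by (intro nn_integral_cmult) measurable
  finally show ?thesis
    using pos by (simp add: ennpow_mult ennpow_ennpow mult.assoc)
qed

section \<open>Lebesgue measure on the tube domain\<close>

lemma continuous_on_tb_rho [continuous_intros]:
  "continuous_on S f \<Longrightarrow> continuous_on S (\<lambda>x. tb_rho e (f x))"
  unfolding tb_rho_def by (intro continuous_intros)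

lemma continuous_on_tb_rho2 [continuous_intros]:
  "continuous_on S f \<Longrightarrow> continuous_on S g \<Longrightarrow> continuous_on S (\<lambda>x. tb_rho2 e (f x) (g x))"
  unfolding tb_rho2_def by (intro continuous_intros)

lemma borel_measurable_tb_rho [measurable]:
  "f \<in> borel_measurable M \<Longrightarrow> (\<lambda>x. tb_rho e (f x)) \<in> borel_measurable M"
  by (rule measurable_compose[of f M borel "tb_rho e"])
     (auto intro!: borel_measurable_continuous_onI continuous_intros)

lemma borel_measurable_tb_rho2 [measurable]:
  "f \<in> borel_measurable M \<Longrightarrow> g \<in> borel_measurable M \<Longrightarrow> (\<lambda>x. tb_rho2 e (f x) (g x)) \<in> borel_measurable M"
  by (rule borel_measurable_continuous_Pair) (auto intro!: continuous_intros)

lemma sets_TB [measurable]: "TB e \<in> sets borel"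
  unfolding TB_def by measurable

text \<open>With y = Im z_j and v = Im u_j, the identity -(y + v)^2 = (y - v)^2 - 2 y^2 - 2 v^2
  yields a square of a difference, and the leftover squares complete Im z_n + Im u_n to rho(z) +
  rho(u). Positivity of the real part is then visible.\<close>

lemma Re_tb_rho2:
  "4 * Re (tb_rho2 e z u) =
     (\<Sum>j\<in>UNIV-{e}. (Re (z$j) - Re (u$j))\<^sup>2 + (Im (z$j) - Im (u$j))\<^sup>2) + 2 * tb_rho e z + 2 * tb_rho e u"
proof -
  have "4 * Re (tb_rho2 e z u) = (\<Sum>j\<in>UNIV-{e}. Re ((z$j - cnj (u$j))^2)) + 2 * (Im (z$e) + Im (u$e))"
    by (simp add: tb_rho2_def)
  also have "(\<Sum>j\<in>UNIV-{e}. Re ((z$j - cnj (u$j))^2)) =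
      (\<Sum>j\<in>UNIV-{e}. ((Re (z$j) - Re (u$j))\<^sup>2 + (Im (z$j) - Im (u$j))\<^sup>2) - 2 * (Im (z$j))\<^sup>2 - 2 * (Im (u$j))\<^sup>2)"
    by (intro sum.cong refl) (simp add: power2_eq_square algebra_simps)
  finally show ?thesis
    by (simp add: tb_rho_def sum_subtractf sum_distrib_left)
qed

lemma Im_tb_rho2:
  "4 * Im (tb_rho2 e z u) =
     2 * (\<Sum>j\<in>UNIV-{e}. (Re (z$j) - Re (u$j)) * (Im (z$j) + Im (u$j))) - 2 * (Re (z$e) - Re (u$e))"
proof -
  have "4 * Im (tb_rho2 e z u) = (\<Sum>j\<in>UNIV-{e}. Im ((z$j - cnj (u$j))^2)) - 2 * (Re (z$e) - Re (u$e))"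
    by (simp add: tb_rho2_def)
  also have "(\<Sum>j\<in>UNIV-{e}. Im ((z$j - cnj (u$j))^2)) =
      (\<Sum>j\<in>UNIV-{e}. 2 * ((Re (z$j) - Re (u$j)) * (Im (z$j) + Im (u$j))))"
    by (intro sum.cong refl) (simp add: power2_eq_square algebra_simps)
  finally show ?thesis
    by (simp add: sum_distrib_left)
qed

lemma tb_rho2_commute: "tb_rho2 e u z = cnj (tb_rho2 e z u)"
proof (rule complex_eqI)
  have "4 * Re (tb_rho2 e u z) = 4 * Re (tb_rho2 e z u)"
    unfolding Re_tb_rho2 by (simp add: power2_commute)
  then show "Re (tb_rho2 e u z) = Re (cnj (tb_rho2 e z u))" by simp
  have "4 * Im (tb_rho2 e u z) = - (4 * Im (tb_rho2 e z u))"
    unfolding Im_tb_rho2 by (simp add: algebra_simps sum_negf[symmetric] sum_subtractf)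
  then show "Im (tb_rho2 e u z) = Im (cnj (tb_rho2 e z u))" by simp
qed

lemma cmod_tb_rho2_commute: "cmod (tb_rho2 e u z) = cmod (tb_rho2 e z u)"
  by (simp add: tb_rho2_commute[of e u z])

lemma Re_tb_rho2_ge: "(tb_rho e z + tb_rho e u) / 2 \<le> Re (tb_rho2 e z u)"
proof -
  have "0 \<le> (\<Sum>j\<in>UNIV-{e}. (Re (z$j) - Re (u$j))\<^sup>2 + (Im (z$j) - Im (u$j))\<^sup>2)"
    by (intro sum_nonneg) auto
  then show ?thesis using Re_tb_rho2[of e z u] by simp
qed

lemma Re_tb_rho2_pos: "z \<in> TB e \<Longrightarrow> u \<in> TB e \<Longrightarrow> 0 < Re (tb_rho2 e z u)"
  using Re_tb_rho2_ge[of e z u] by (auto simp: TB_def)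

lemma cmod_tb_rho2_ge: "u \<in> TB e \<Longrightarrow> tb_rho e z / 2 \<le> cmod (tb_rho2 e z u)"
  using Re_tb_rho2_ge[of e z u] complex_Re_le_cmod[of "tb_rho2 e z u"] by (auto simp: TB_def)

section \<open>Invariance of Lebesgue measure and integrals over boxes\<close>

lemma nn_integral_lborel_translation:
  fixes f :: "'a::euclidean_space \<Rightarrow> ennreal"
  assumes [measurable]: "f \<in> borel_measurable borel"
  shows "(\<integral>\<^sup>+x. f (t + x) \<partial>lborel) = (\<integral>\<^sup>+x. f x \<partial>lborel)"
  by (subst (2) lborel_affine[of 1 t]) (simp_all add: nn_integral_density nn_integral_distr)

lemma nn_integral_lborel_reflection:
  fixes f :: "'a::euclidean_space \<Rightarrow> ennreal"
  assumes [measurable]: "f \<in> borel_measurable borel"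
  shows "(\<integral>\<^sup>+x. f (t - x) \<partial>lborel) = (\<integral>\<^sup>+x. f x \<partial>lborel)"
  by (subst (2) lborel_affine[of "-1" t]) (simp_all add: nn_integral_density nn_integral_distr)

lemma borel_measurable_axis [measurable]:
  "f \<in> borel_measurable M \<Longrightarrow> (\<lambda>x. axis e (f x :: complex)) \<in> borel_measurable M"
proof -
  have "continuous_on UNIV (\<lambda>x::complex. if i = e then x else 0)" for i
    by (cases "i = e") auto
  then have "continuous_on UNIV (\<lambda>x. axis e (x::complex))"
    unfolding axis_def by (intro continuous_on_vec_lambda)
  from borel_measurable_continuous_onI[OF this]
  show "f \<in> borel_measurable M \<Longrightarrow> (\<lambda>x. axis e (f x :: complex)) \<in> borel_measurable M"
    by (rule measurable_compose[rotated])
qed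

lemma borel_measurable_vec_nth' [measurable]:
  "f \<in> borel_measurable M \<Longrightarrow> (\<lambda>x. (f x :: complex^'n) $ i) \<in> borel_measurable M"
  by (rule measurable_compose[of f M borel "\<lambda>x. x $ i"])
     (auto intro!: borel_measurable_continuous_onI continuous_intros)

text \<open>Averaging over translations in the coordinate \<open>e\<close> reduces the invariance of Lebesgue measure
  under a nonlinear shear to its invariance under translations.\<close>
lemma nn_integral_shear:
  fixes f :: "complex^'n \<Rightarrow> ennreal"
  assumes [measurable]: "f \<in> borel_measurable borel" "m \<in> borel_measurable borel"
    and m: "\<And>u \<tau>. m (u + axis e \<tau>) = m u"
  shows "(\<integral>\<^sup>+u. f (u + axis e (m u)) \<partial>lborel) = (\<integral>\<^sup>+u. f u \<partial>lborel)"
proof -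
  \<comment> \<open>A function of integral 1, whose translates bring in the averaging variable
    \<tau> without changing the integral.\<close>
  define H :: "complex \<Rightarrow> ennreal" where "H = indicator (cbox 0 (Complex 1 1))"
  have [measurable]: "H \<in> borel_measurable borel" unfolding H_def by measurable
  have "integral\<^sup>N lborel H = 1"
    unfolding H_def by (simp, subst emeasure_lborel_cbox) (auto simp: Basis_complex_def)
  then have H1: "(\<integral>\<^sup>+\<tau>. H (c + \<tau>) \<partial>lborel) = 1" for c
    by (simp add: nn_integral_lborel_translation)
  have add_axis: "axis e (a + b) = axis e a + axis e (b::complex)" for a b
    by (simp add: axis_def vec_eq_iff)
  have *: "(\<integral>\<^sup>+u. f (u + axis e (m u)) \<partial>lborel)
      = (\<integral>\<^sup>+u. H (u$e) * (\<integral>\<^sup>+\<tau>. f (u + axis e \<tau>) \<partial>lborel) \<partial>lborel)"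
    if [measurable]: "m \<in> borel_measurable borel" and m: "\<And>u \<tau>. m (u + axis e \<tau>) = m u" for m
  proof -
    have "(\<integral>\<^sup>+u. f (u + axis e (m u)) \<partial>lborel)
       = (\<integral>\<^sup>+u. (\<integral>\<^sup>+\<tau>. f (u + axis e (m u)) * H (u$e + \<tau>) \<partial>lborel) \<partial>lborel)"
      by (simp add: nn_integral_cmult H1)
    also have "\<dots> = (\<integral>\<^sup>+\<tau>. (\<integral>\<^sup>+u. f (u + axis e (m u)) * H (u$e + \<tau>) \<partial>lborel) \<partial>lborel)"
      by (intro lborel_pair.Fubini'[symmetric]) measurable
    \<comment> \<open>Translation of u by -\<tau> in the coordinate e frees H of \<tau> and moves
      \<tau> into the amount of the shear, because m ignores that coordinate.\<close>
    also have "\<dots> = (\<integral>\<^sup>+\<tau>. (\<integral>\<^sup>+u. f (u + axis e (m u - \<tau>)) * H (u$e) \<partial>lborel) \<partial>lborel)"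
    proof (rule nn_integral_cong)
      fix \<tau> :: complex
      have "(\<integral>\<^sup>+u. f (u + axis e (m u)) * H (u$e + \<tau>) \<partial>lborel)
         = (\<integral>\<^sup>+u. f ((axis e (-\<tau>) + u) + axis e (m (axis e (-\<tau>) + u))) * H ((axis e (-\<tau>) + u)$e + \<tau>) \<partial>lborel)"
        by (rule nn_integral_lborel_translation[symmetric]) measurable
      also have "\<dots> = (\<integral>\<^sup>+u. f (u + axis e (m u - \<tau>)) * H (u$e) \<partial>lborel)"
      proof (intro nn_integral_cong)
        fix u
        have "axis e (-\<tau>) + u + axis e (m (axis e (-\<tau>) + u)) = u + axis e (m u - \<tau>)"
          using m[of u "-\<tau>"] add_axis[of "m u" "-\<tau>"] by (simp add: add_ac)
        moreover have "(axis e (-\<tau>) + u)$e + \<tau> = u$e" by (simp add: axis_def)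
        ultimately show "f ((axis e (-\<tau>) + u) + axis e (m (axis e (-\<tau>) + u))) * H ((axis e (-\<tau>) + u)$e + \<tau>)
            = f (u + axis e (m u - \<tau>)) * H (u$e)" by (simp only:)
      qed
      finally show "(\<integral>\<^sup>+u. f (u + axis e (m u)) * H (u$e + \<tau>) \<partial>lborel)
         = (\<integral>\<^sup>+u. f (u + axis e (m u - \<tau>)) * H (u$e) \<partial>lborel)" .
    qed
    also have "\<dots> = (\<integral>\<^sup>+u. (\<integral>\<^sup>+\<tau>. f (u + axis e (m u - \<tau>)) * H (u$e) \<partial>lborel) \<partial>lborel)"
      by (intro lborel_pair.Fubini') measurable
    also have "\<dots> = (\<integral>\<^sup>+u. H (u$e) * (\<integral>\<^sup>+\<tau>. f (u + axis e \<tau>) \<partial>lborel) \<partial>lborel)"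
    proof (rule nn_integral_cong)
      fix u
      \<comment> \<open>For fixed u, the reflection of \<tau> at m(u) makes m disappear.\<close>
      have "(\<integral>\<^sup>+\<tau>. f (u + axis e (m u - \<tau>)) \<partial>lborel) = (\<integral>\<^sup>+\<tau>. f (u + axis e \<tau>) \<partial>lborel)"
        by (rule nn_integral_lborel_reflection) measurable
      then show "(\<integral>\<^sup>+\<tau>. f (u + axis e (m u - \<tau>)) * H (u$e) \<partial>lborel) = H (u$e) * (\<integral>\<^sup>+\<tau>. f (u + axis e \<tau>) \<partial>lborel)"
        by (simp add: nn_integral_multc) (simp add: mult.commute)
    qed
    finally show ?thesis .
  qed
  have axis_0: "axis e (0::complex) = (0::complex^'n)" by (simp add: axis_def vec_eq_iff)
  \<comment> \<open>The averaged expression no longer contains m, so the shears by m and by 0 have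
    the same integral.\<close>
  show ?thesis using *[of m] *[of "\<lambda>_. 0"] m by (simp add: axis_0)
qed

text \<open>A cylinder: the coordinate e stays free, since it is restricted separately through Re
  u_n and rho(u).\<close>

definition tbox :: "'n::finite \<Rightarrow> complex^'n \<Rightarrow> real \<Rightarrow> (complex^'n) set" where
  "tbox e c A = {u. \<forall>j. j \<noteq> e \<longrightarrow> \<bar>Re (u$j - c$j)\<bar> \<le> A \<and> \<bar>Im (u$j - c$j)\<bar> \<le> A}"

lemma sets_tbox [measurable]: "tbox e c A \<in> sets borel"
  unfolding tbox_def by measurable

lemma Basis_cvec: "(Basis :: (complex^'n) set) = (\<lambda>(j, k). axis j k) ` (UNIV \<times> {1, \<i>})"
  by (auto simp: Basis_vec_def Basis_complex_def)

text \<open>The integrand is a product of functions of single real coordinates, one for each element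
  of \<open>Basis\<close>; the 2n-2 coordinates of u' give the factors 2A.\<close>

lemma nn_integral_tbox_straight:
  fixes e :: "'n::finite" and g :: "real \<Rightarrow> ennreal"
  assumes [measurable]: "g \<in> borel_measurable borel" and A: "0 \<le> A" and B: "0 \<le> B"
  shows "(\<integral>\<^sup>+u. indicator (tbox e c A) u * indicator {-B..B} (Re (u$e)) * g (Im (u$e)) \<partial>lborel)
    = ennreal ((2 * A) ^ (2 * CARD('n) - 2) * (2 * B)) * (\<integral>\<^sup>+t. g t \<partial>lborel)"
proof -
  let ?b1 = "axis e 1 :: complex^'n" and ?b2 = "axis e \<i> :: complex^'n"
  define R where "R = (Basis :: (complex^'n) set) - {?b1, ?b2}"
  define f :: "complex^'n \<Rightarrow> real \<Rightarrow> ennreal" where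
    "f b = (if b = ?b1 then indicator {-B..B} else if b = ?b2 then g else indicator {c \<bullet> b - A..c \<bullet> b + A})" for b
  have ne: "?b1 \<noteq> ?b2" by (simp add: axis_eq_axis complex_eq_iff)
  have f1: "f ?b1 = indicator {-B..B}" and f2: "f ?b2 = g" using ne by (auto simp: f_def)
  have inB: "?b1 \<in> Basis" "?b2 \<in> Basis" by (auto simp: Basis_cvec)
  have BR: "Basis = insert ?b1 (insert ?b2 R)" "?b1 \<notin> insert ?b2 R" "?b2 \<notin> R" "finite R"
    using inB ne by (auto simp: R_def)
  have "card (insert ?b1 (insert ?b2 R)) = 2 + card R"
    using BR(2-4) by simp
  then have "card (Basis :: (complex^'n) set) = 2 + card R" by (simp only: BR(1)[symmetric])
  then have cardR: "card R = 2 * CARD('n) - 2" by simp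
  have prodB: "(\<Prod>b\<in>Basis. h b) = h ?b1 * h ?b2 * (\<Prod>b\<in>R. h b)" for h :: "complex^'n \<Rightarrow> ennreal"
    using BR(2-4) unfolding BR(1) by (simp add: mult.assoc)
  have tb: "u \<in> tbox e c A \<longleftrightarrow> (\<forall>b\<in>R. u \<bullet> b \<in> {c \<bullet> b - A..c \<bullet> b + A})" for u
  proof -
    have "R = (\<lambda>(j, k). axis j k) ` ((UNIV - {e}) \<times> {1, \<i>})"
      by (auto simp: R_def Basis_cvec axis_eq_axis)
    then show ?thesis
      by (auto simp: tbox_def inner_axis abs_le_iff algebra_simps)
  qed
  have ind: "(\<Prod>b\<in>R. f b (u \<bullet> b)) = indicator (tbox e c A) u" for u
  proof -
    have "(\<Prod>b\<in>R. f b (u \<bullet> b)) = (\<Prod>b\<in>R. indicator {c \<bullet> b - A..c \<bullet> b + A} (u \<bullet> b))"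
      using BR by (intro prod.cong refl) (auto simp: f_def)
    also have "\<dots> = indicator (tbox e c A) u"
      unfolding tb indicator_def using BR by (auto simp: tb)
    finally show ?thesis .
  qed
  have "(\<integral>\<^sup>+u. indicator (tbox e c A) u * indicator {-B..B} (Re (u$e)) * g (Im (u$e)) \<partial>lborel)
     = (\<integral>\<^sup>+u. (\<Prod>b\<in>Basis. f b (u \<bullet> b)) \<partial>lborel)"
    by (intro nn_integral_cong) (simp add: prodB ind f1 f2 inner_axis mult_ac)
  also have "\<dots> = (\<Prod>b\<in>Basis. (\<integral>\<^sup>+t. f b t \<partial>lborel))"
    by (intro nn_integral_lborel_prod) (auto simp: f_def)
  also have "\<dots> = ennreal (2 * B) * (\<integral>\<^sup>+t. g t \<partial>lborel) * (\<Prod>b\<in>R. (\<integral>\<^sup>+t. f b t \<partial>lborel))"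
    using B by (simp add: prodB f1 f2)
  also have "(\<Prod>b\<in>R. (\<integral>\<^sup>+t. f b t \<partial>lborel)) = (\<Prod>b\<in>R. ennreal (2 * A))"
    using BR A by (intro prod.cong refl) (auto simp: f_def)
  also have "\<dots> = ennreal ((2 * A) ^ (2 * CARD('n) - 2))"
    using A by (simp add: cardR ennreal_power)
  finally show ?thesis using A B by (simp add: ennreal_mult mult_ac)
qed

text \<open>The shear amount has imaginary part |Im u'|^2, which straightens rho, and real part
  r(u), which straightens a window for Re u_n whose centre depends on u'. The curved box becomes a
  straight one and the function of rho separates.\<close>

lemma nn_integral_tbox:
  fixes e :: "'n::finite" and g :: "real \<Rightarrow> ennreal"
  assumes [measurable]: "g \<in> borel_measurable borel" "r \<in> borel_measurable borel"
    and r: "\<And>u \<tau>. r (u + axis e \<tau>) = r u" and A: "0 \<le> A" and B: "0 \<le> B"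
  shows "(\<integral>\<^sup>+u. indicator (tbox e c A) u * indicator {-B..B} (Re (u$e) - r u) * g (tb_rho e u) \<partial>lborel)
    = ennreal ((2 * A) ^ (2 * CARD('n) - 2) * (2 * B)) * (\<integral>\<^sup>+t. g t \<partial>lborel)"
proof -
  define m where "m u = Complex (r u) (\<Sum>j\<in>UNIV-{e}. (Im (u$j))^2)" for u :: "complex^'n"
  have m: "m (u + axis e \<tau>) = m u" for u \<tau>
    unfolding m_def r by (rule arg_cong[of _ _ "Complex _"]) (auto simp: axis_def intro!: sum.cong)
  have [measurable]: "m \<in> borel_measurable borel"
    unfolding m_def Complex_eq by measurable
  have 1: "tb_rho e (u + axis e (m u)) = Im (u$e)" for u
    by (simp add: tb_rho_def axis_def m_def)
  have 2: "Re ((u + axis e (m u))$e) - r (u + axis e (m u)) = Re (u$e)" for u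
    unfolding r by (simp add: axis_def m_def)
  have 3: "u + axis e (m u) \<in> tbox e c A \<longleftrightarrow> u \<in> tbox e c A" for u
    by (simp add: tbox_def axis_def)
  have "(\<integral>\<^sup>+u. indicator (tbox e c A) u * indicator {-B..B} (Re (u$e) - r u) * g (tb_rho e u) \<partial>lborel)
    = (\<integral>\<^sup>+u. indicator (tbox e c A) (u + axis e (m u)) * indicator {-B..B} (Re ((u + axis e (m u))$e) - r (u + axis e (m u)))
        * g (tb_rho e (u + axis e (m u))) \<partial>lborel)"
    by (rule nn_integral_shear[OF _ _ m, symmetric]) measurable
  also have "\<dots> = (\<integral>\<^sup>+u. indicator (tbox e c A) u * indicator {-B..B} (Re (u$e)) * g (Im (u$e)) \<partial>lborel)"
    unfolding 1 2 by (simp add: 3 indicator_def)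
  also have "\<dots> = ennreal ((2 * A) ^ (2 * CARD('n) - 2) * (2 * B)) * (\<integral>\<^sup>+t. g t \<partial>lborel)"
    using A B by (intro nn_integral_tbox_straight) auto
  finally show ?thesis .
qed

lemma nn_integral_powr_from_0:
  assumes "-1 < s" "0 \<le> h"
  shows "(\<integral>\<^sup>+t. indicator {0..h} t * ennreal (t powr s) \<partial>lborel) = ennreal (h powr (s + 1) / (s + 1))"
proof -
  have "(\<integral>\<^sup>+t. ennreal (indicator {0..h} t * t powr s) \<partial>lborel) = ennreal (h powr (s + 1) / (s + 1))"
    using assms by (intro nn_integral_has_integral_lebesgue has_integral_powr_from_0) auto
  then show ?thesis by (simp add: ennreal_mult' ennreal_indicator)
qed

section \<open>Forelli--Rudin estimate\<close>

text \<open>The sublevel set lies in a curved box. By \<open>Re_tb_rho2\<close> each real coordinate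
  of u' - z' is at most 2 sqrt R in absolute value and rho(u) <= 2R; by \<open>Im_tb_rho2\<close>
  the distance of Re u_n from r(u) is at most 2R. Only R enters the bound, with exponent (n - 1) + 1
  + (s + 1).\<close>

lemma nn_integral_tb_rho2_sublevel:
  fixes e :: "'n::finite"
  assumes s: "(-1::real) < s" and R: "0 < R" and z: "0 \<le> tb_rho e z"
  shows "(\<integral>\<^sup>+u. indicator (TB e) u * indicator {u. cmod (tb_rho2 e z u) \<le> R} u * ennreal (tb_rho e u powr s) \<partial>lborel)
    \<le> ennreal (4 ^ (2 * CARD('n) - 1) * 2 powr (s + 1) / (s + 1) * R powr (real CARD('n) + s + 1))"
proof -
  \<comment> \<open>For given z and u', the value of Re u_n at which Im rho(z,u) vanishes.\<close>
  define r where "r u = Re (z$e) - (\<Sum>j\<in>UNIV-{e}. (Re (z$j) - Re (u$j)) * (Im (z$j) + Im (u$j)))" for u :: "complex^'n"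
  have [measurable]: "r \<in> borel_measurable borel" unfolding r_def by measurable
  have r: "r (u + axis e \<tau>) = r u" for u \<tau>
    unfolding r_def by (rule arg_cong[of _ _ "\<lambda>x. _ - x"]) (auto simp: axis_def intro!: sum.cong)
  have le: "indicator (TB e) u * indicator {u. cmod (tb_rho2 e z u) \<le> R} u * ennreal (tb_rho e u powr s)
     \<le> indicator (tbox e z (2 * sqrt R)) u * indicator {-(2*R)..2*R} (Re (u$e) - r u)
        * (indicator {0..2*R} (tb_rho e u) * ennreal (tb_rho e u powr s))"
    for u
  proof (cases "u \<in> TB e \<and> cmod (tb_rho2 e z u) \<le> R")
    case True
    then have u: "0 < tb_rho e u" by (simp add: TB_def)
    have Re: "Re (tb_rho2 e z u) \<le> R" and Im: "\<bar>Im (tb_rho2 e z u)\<bar> \<le> R"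
      using True complex_Re_le_cmod[of "tb_rho2 e z u"] abs_Im_le_cmod[of "tb_rho2 e z u"] by linarith+
    have comp: "(Re (z$j) - Re (u$j))\<^sup>2 + (Im (z$j) - Im (u$j))\<^sup>2 \<le> 4 * R" if "j \<noteq> e" for j
    proof -
      have "(Re (z$j) - Re (u$j))\<^sup>2 + (Im (z$j) - Im (u$j))\<^sup>2
          \<le> (\<Sum>j\<in>UNIV-{e}. (Re (z$j) - Re (u$j))\<^sup>2 + (Im (z$j) - Im (u$j))\<^sup>2)"
        using that by (intro member_le_sum[of j _ "\<lambda>j. (Re (z$j) - Re (u$j))\<^sup>2 + (Im (z$j) - Im (u$j))\<^sup>2"]) auto
      then show ?thesis using Re_tb_rho2[of e z u] Re u z by linarith
    qed
    have sq: "\<bar>x\<bar> \<le> 2 * sqrt R" if "x\<^sup>2 \<le> 4 * R" for x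
      using real_sqrt_le_mono[OF that] by (simp add: real_sqrt_mult)
    have "u \<in> tbox e z (2 * sqrt R)"
      unfolding tbox_def
    proof (intro CollectI allI impI conjI)
      fix j assume j: "j \<noteq> e"
      have "(Re (u$j - z$j))\<^sup>2 \<le> 4 * R" "(Im (u$j - z$j))\<^sup>2 \<le> 4 * R"
        using comp[OF j] zero_le_power2[of "Re (z$j) - Re (u$j)"] zero_le_power2[of "Im (z$j) - Im (u$j)"]
        unfolding minus_complex.sel power2_commute[of "Re (u$j)"] power2_commute[of "Im (u$j)"] by linarith+
      then show "\<bar>Re (u$j - z$j)\<bar> \<le> 2 * sqrt R" "\<bar>Im (u$j - z$j)\<bar> \<le> 2 * sqrt R"
        by (blast intro: sq)+
    qed
    moreover have "Re (u$e) - r u = 2 * Im (tb_rho2 e z u)"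
      using Im_tb_rho2[of e z u] by (simp add: r_def)
    then have "Re (u$e) - r u \<in> {-(2*R)..2*R}"
      using Im by auto
    moreover have "tb_rho e u \<in> {0..2*R}"
      using Re_tb_rho2_ge[of e z u] Re u z by auto
    ultimately show ?thesis using True by simp
  qed auto
  have "(\<integral>\<^sup>+u. indicator (TB e) u * indicator {u. cmod (tb_rho2 e z u) \<le> R} u * ennreal (tb_rho e u powr s) \<partial>lborel)
    \<le> (\<integral>\<^sup>+u. indicator (tbox e z (2 * sqrt R)) u * indicator {-(2*R)..2*R} (Re (u$e) - r u)
        * (indicator {0..2*R} (tb_rho e u) * ennreal (tb_rho e u powr s)) \<partial>lborel)"
    by (intro nn_integral_mono le)
  also have "\<dots> = ennreal ((2 * (2 * sqrt R)) ^ (2 * CARD('n) - 2) * (2 * (2 * R)))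
      * (\<integral>\<^sup>+t. indicator {0..2*R} t * ennreal (t powr s) \<partial>lborel)"
    using R by (intro nn_integral_tbox[OF _ _ r]) auto
  also have "\<dots> = ennreal ((2 * (2 * sqrt R)) ^ (2 * CARD('n) - 2) * (2 * (2 * R)) * ((2 * R) powr (s + 1) / (s + 1)))"
    unfolding nn_integral_powr_from_0[OF s, of "2 * R", OF less_imp_le, OF mult_pos_pos[OF zero_less_numeral R]]
    using s R by (intro ennreal_mult[symmetric]) auto
  also have "(2 * (2 * sqrt R)) ^ (2 * CARD('n) - 2) * (2 * (2 * R)) * ((2 * R) powr (s + 1) / (s + 1))
     = 4 ^ (2 * CARD('n) - 1) * 2 powr (s + 1) / (s + 1) * R powr (real CARD('n) + s + 1)"
  proof -
    obtain k where k: "CARD('n) = Suc k" using zero_less_card_finite[where 'a='n] gr0_implies_Suc by blast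
    have "sqrt R ^ (2 * k) = R powr k"
      using R by (simp add: power_mult powr_realpow)
    then show ?thesis
      using R by (simp add: k power_mult_distrib powr_mult powr_add field_simps power2_eq_square)
  qed
  finally show ?thesis .
qed

text \<open>No u in the domain has |rho(z,u)| below rho(z)/2, so the shells ending at 2^k rho(z)
  with k >= 0 suffice. By the sublevel estimate the k-th shell contributes a constant times
  rho(z)^(N-d) 2^(k(N-d)), where N = n + 1 + s, and d > N makes the geometric series
  converge.\<close>

theorem Forelli_Rudin:
  fixes e :: "'n::finite"
  assumes s: "(-1::real) < s" and d: "real CARD('n) + 1 + s < d"
  obtains C where "0 \<le> C" "\<And>z. z \<in> TB e \<Longrightarrow>
    (\<integral>\<^sup>+u. indicator (TB e) u * ennreal (tb_rho e u powr s * cmod (tb_rho2 e z u) powr (-d)) \<partial>lborel)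
      \<le> ennreal (C * tb_rho e z powr (real CARD('n) + 1 + s - d))"
proof -
  define N where "N = real CARD('n) + 1 + s"
  define K where "K = 4 ^ (2 * CARD('n) - 1) * 2 powr (s + 1) / (s + 1)"
  have K: "0 < K" using s by (simp add: K_def)
  have d0: "0 < d" using s d by linarith
  define q where "q = 2 powr (N - d)"
  have "2 powr (N - d) < 2 powr 0" using d by (intro powr_less_mono) (auto simp: N_def)
  then have q: "0 < q" "q < 1" by (auto simp: q_def)
  define C where "C = K * 2 powr d * (1 / (1 - q))"
  have "(\<integral>\<^sup>+u. indicator (TB e) u * ennreal (tb_rho e u powr s * cmod (tb_rho2 e z u) powr (-d)) \<partial>lborel)
      \<le> ennreal (C * tb_rho e z powr (N - d))" if zT: "z \<in> TB e" for z
  proof -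
    define t where "t = tb_rho e z"
    have t: "0 < t" using zT by (simp add: t_def TB_def)
    define a where "a k = (2 ^ k * t / 2) powr (-d)" for k :: nat
    have pw: "indicator (TB e) u * ennreal (tb_rho e u powr s * cmod (tb_rho2 e z u) powr (-d))
      \<le> (\<Sum>k. ennreal (a k) * (indicator (TB e) u * indicator {u. cmod (tb_rho2 e z u) \<le> 2 ^ k * t} u * ennreal (tb_rho e u powr s)))"
      (is "_ \<le> (\<Sum>k. ?g k)") for u
    proof (cases "u \<in> TB e")
      case True
      define v where "v = cmod (tb_rho2 e z u)"
      have v: "t / 2 \<le> v" using cmod_tb_rho2_ge[OF True, of z] by (simp add: v_def t_def)
      have "\<exists>k::nat. v \<le> 2 ^ k * t"
      proof -
        obtain k :: nat where "v / t < 2 ^ k" using real_arch_pow[of 2 "v / t"] by auto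
        then show ?thesis using t by (intro exI[of _ k]) (simp add: field_simps)
      qed
      \<comment> \<open>The least such k also bounds v from below: by minimality if k > 0, and by v
        >= t/2 if k = 0.\<close>
      define k where "k = (LEAST k::nat. v \<le> 2 ^ k * t)"
      have k: "v \<le> 2 ^ k * t" unfolding k_def by (rule LeastI_ex) fact
      have k': "2 ^ k * t / 2 \<le> v"
      proof (cases k)
        case 0 then show ?thesis using v by simp
      next
        case (Suc m)
        then have "\<not> v \<le> 2 ^ m * t" using not_less_Least[of m "\<lambda>k. v \<le> 2 ^ k * t"] by (simp add: k_def)
        then show ?thesis using Suc by simp
      qed
      have "v powr (-d) \<le> a k"
        unfolding a_def using k' t d0 by (intro powr_mono2') auto
      then have "ennreal (tb_rho e u powr s * v powr (-d)) \<le> ennreal (a k * tb_rho e u powr s)"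
        by (intro ennreal_leI) (metis mult.commute mult_right_mono powr_ge_zero)
      then have "indicator (TB e) u * ennreal (tb_rho e u powr s * v powr (-d)) \<le> ?g k"
        using True k by (simp add: v_def[symmetric] ennreal_mult a_def)
      also have "\<dots> \<le> (\<Sum>k. ?g k)"
        using sum_le_suminf[of ?g "{k}"] by simp
      finally show ?thesis by (simp add: v_def)
    qed simp
    have "(\<integral>\<^sup>+u. indicator (TB e) u * ennreal (tb_rho e u powr s * cmod (tb_rho2 e z u) powr (-d)) \<partial>lborel)
       \<le> (\<integral>\<^sup>+u. (\<Sum>k. ennreal (a k) * (indicator (TB e) u * indicator {u. cmod (tb_rho2 e z u) \<le> 2 ^ k * t} u * ennreal (tb_rho e u powr s))) \<partial>lborel)"
      by (intro nn_integral_mono pw)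
    also have "\<dots> = (\<Sum>k. (\<integral>\<^sup>+u. ennreal (a k) * (indicator (TB e) u * indicator {u. cmod (tb_rho2 e z u) \<le> 2 ^ k * t} u * ennreal (tb_rho e u powr s)) \<partial>lborel))"
      by (intro nn_integral_suminf) measurable
    also have "\<dots> \<le> (\<Sum>k. ennreal (K * 2 powr d * t powr (N - d) * q ^ k))"
    proof (intro suminf_le summableI)
      fix k :: nat
      have "(\<integral>\<^sup>+u. ennreal (a k) * (indicator (TB e) u * indicator {u. cmod (tb_rho2 e z u) \<le> 2 ^ k * t} u * ennreal (tb_rho e u powr s)) \<partial>lborel)
        = ennreal (a k) * (\<integral>\<^sup>+u. indicator (TB e) u * indicator {u. cmod (tb_rho2 e z u) \<le> 2 ^ k * t} u * ennreal (tb_rho e u powr s) \<partial>lborel)"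
        by (intro nn_integral_cmult) measurable
      also have "\<dots> \<le> ennreal (a k) * ennreal (K * (2 ^ k * t) powr (real CARD('n) + s + 1))"
        unfolding K_def using s t by (intro mult_left_mono nn_integral_tb_rho2_sublevel) (auto simp: t_def)
      also have "\<dots> = ennreal (a k * (K * (2 ^ k * t) powr N))"
        using K by (simp add: a_def ennreal_mult N_def add_ac)
      also have "a k * (K * (2 ^ k * t) powr N) = K * 2 powr d * t powr (N - d) * q ^ k"
      proof -
        have "a k * (K * (2 ^ k * t) powr N) = K * 2 powr d * (2 ^ k * t) powr (N - d)"
          using t by (simp add: a_def powr_divide powr_diff powr_minus field_simps)
        also have "(2 ^ k * t) powr (N - d) = t powr (N - d) * q ^ k"
          using t by (simp add: q_def powr_mult powr_realpow[symmetric] powr_powr mult.commute)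
        finally show ?thesis by simp
      qed
      finally show "(\<integral>\<^sup>+u. ennreal (a k) * (indicator (TB e) u * indicator {u. cmod (tb_rho2 e z u) \<le> 2 ^ k * t} u * ennreal (tb_rho e u powr s)) \<partial>lborel)
         \<le> ennreal (K * 2 powr d * t powr (N - d) * q ^ k)" .
    qed
    also have "\<dots> = ennreal (K * 2 powr d * t powr (N - d) * (1 / (1 - q)))"
      using K q by (intro suminf_ennreal_eq sums_mult geometric_sums) auto
    finally show ?thesis by (simp add: C_def t_def mult_ac)
  qed
  moreover have "0 \<le> C" using K q by (simp add: C_def)
  ultimately show thesis using that[of C] by (simp add: N_def)
qed

section \<open>Boundedness of the positive kernel in one variable\<close>

text \<open>A weighted L^p norm of \<open>ennreal\<close>-valued functions, so that it can be nested
  for the mixed norm and applied to integrals of absolute values before these are known to be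
  finite.\<close>

definition wnorm :: "'n::finite \<Rightarrow> real \<Rightarrow> real \<Rightarrow> (complex^'n \<Rightarrow> ennreal) \<Rightarrow> ennreal" where
  "wnorm e p al f = ennpow (\<integral>\<^sup>+z. indicator (TB e) z * ennpow (f z) p * ennreal (tb_rho e z powr al) \<partial>lborel) (1 / p)"

definition kint :: "'n::finite \<Rightarrow> (complex^'n \<Rightarrow> complex^'n \<Rightarrow> ennreal) \<Rightarrow> (complex^'n \<Rightarrow> ennreal) \<Rightarrow> complex^'n \<Rightarrow> ennreal" where
  "kint e k f z = (\<integral>\<^sup>+u. indicator (TB e) u * k z u * f u \<partial>lborel)"

definition kern1 :: "'n::finite \<Rightarrow> real \<Rightarrow> real \<Rightarrow> real \<Rightarrow> complex^'n \<Rightarrow> complex^'n \<Rightarrow> ennreal" where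
  "kern1 e a b c z u = ennreal (tb_rho e z powr a * tb_rho e u powr b * cmod (tb_rho2 e z u) powr (-c))"

lemma mixnorm_eq_wnorm:
  assumes "0 < fst p" "0 < snd p"
  shows "mixnorm e p al f = wnorm e (snd p) (snd al) (\<lambda>w. wnorm e (fst p) (fst al) (\<lambda>z. ennreal (cmod (f (z, w)))))"
  using assms unfolding mixnorm_def wnorm_def
  by (simp add: ennpow_ennpow ennpow_ennreal ennreal_mult mult.assoc)

lemma wnorm_mono:
  assumes "0 < p" "\<And>z. z \<in> TB e \<Longrightarrow> f z \<le> g z"
  shows "wnorm e p al f \<le> wnorm e p al g"
  unfolding wnorm_def using assms
  by (auto intro!: ennpow_mono nn_integral_mono mult_right_mono split: split_indicator)

lemma wnorm_cmult:
  assumes "0 < p" and [measurable]: "f \<in> borel_measurable borel"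
  shows "wnorm e p al (\<lambda>z. c * f z) = c * wnorm e p al f"
proof -
  have "(\<integral>\<^sup>+z. indicator (TB e) z * ennpow (c * f z) p * ennreal (tb_rho e z powr al) \<partial>lborel)
     = (\<integral>\<^sup>+z. ennpow c p * (indicator (TB e) z * ennpow (f z) p * ennreal (tb_rho e z powr al)) \<partial>lborel)"
    by (simp add: ennpow_mult mult_ac)
  also have "\<dots> = ennpow c p * (\<integral>\<^sup>+z. indicator (TB e) z * ennpow (f z) p * ennreal (tb_rho e z powr al) \<partial>lborel)"
    by (intro nn_integral_cmult) measurable
  finally show ?thesis using assms by (simp add: wnorm_def ennpow_mult ennpow_ennpow)
qed

lemma borel_measurable_wnorm [measurable]:
  assumes [measurable]: "(\<lambda>(x, z). f x z) \<in> borel_measurable (M \<Otimes>\<^sub>M borel)"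
  shows "(\<lambda>x. wnorm e p al (f x)) \<in> borel_measurable M"
proof -
  have [measurable]: "(\<lambda>(x, z). f x z) \<in> borel_measurable (M \<Otimes>\<^sub>M lborel)"
    using assms by (simp cong: measurable_cong_sets sets_pair_measure_cong)
  show ?thesis unfolding wnorm_def by measurable
qed

lemma wnorm_Minkowski:
  fixes G :: "complex^'n \<Rightarrow> complex^'n \<Rightarrow> ennreal"
  assumes q: "1 \<le> q" and [measurable]: "(\<lambda>(z, x). G z x) \<in> borel_measurable (borel \<Otimes>\<^sub>M borel)"
  shows "wnorm e q be (\<lambda>z. \<integral>\<^sup>+x. G z x \<partial>lborel) \<le> (\<integral>\<^sup>+x. wnorm e q be (\<lambda>z. G z x) \<partial>lborel)"
proof -
  \<comment> \<open>Absorbs the weight: the q-th power of W is rho^be on the domain and 0 outside,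
    so the unweighted inequality applies.\<close>
  define W where "W z = indicator (TB e) z * ennreal (tb_rho e z powr (be / q))" for z
  have [measurable]: "W \<in> borel_measurable borel" unfolding W_def by measurable
  have W: "ennpow (W z * y) q = indicator (TB e) z * ennpow y q * ennreal (tb_rho e z powr be)" for z y
    using q by (auto simp: W_def ennpow_mult ennpow_ennreal powr_powr mult.commute split: split_indicator)
  have [measurable]: "(\<lambda>x. G z x) \<in> borel_measurable borel" for z by measurable
  have "wnorm e q be (\<lambda>z. \<integral>\<^sup>+x. G z x \<partial>lborel) = ennpow (\<integral>\<^sup>+z. ennpow (\<integral>\<^sup>+x. W z * G z x \<partial>lborel) q \<partial>lborel) (1 / q)"
    by (simp add: wnorm_def W nn_integral_cmult)
  also have "\<dots> \<le> (\<integral>\<^sup>+x. ennpow (\<integral>\<^sup>+z. ennpow (W z * G z x) q \<partial>lborel) (1 / q) \<partial>lborel)"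
    using q by (intro nn_integral_Minkowski) (auto intro: sigma_finite_lborel)
  also have "\<dots> = (\<integral>\<^sup>+x. wnorm e q be (\<lambda>z. G z x) \<partial>lborel)"
    by (simp add: wnorm_def W)
  finally show ?thesis .
qed

lemma kern1_measurable [measurable]:
  assumes [measurable]: "f \<in> borel_measurable M" "g \<in> borel_measurable M"
  shows "(\<lambda>x. kern1 e a b c (f x) (g x)) \<in> borel_measurable M"
  unfolding kern1_def by measurable

lemma kern1_bounded:
  fixes e :: "'n::finite"
  defines "n \<equiv> real CARD('n)"
  assumes p: "1 < p" and pq: "p \<le> q" and a: "- q * a < be + 1" and b: "al + 1 < p * (b + 1)"
    and c: "c = n + 1 + a + b + ((n + 1 + be) / q - (n + 1 + al) / p)"
  obtains C where "0 \<le> C"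
    "\<And>f. f \<in> borel_measurable borel \<Longrightarrow> wnorm e q be (kint e (kern1 e a b c) f) \<le> ennreal C * wnorm e p al f"
proof -
  define p' where "p' = p / (p - 1)"
  have p': "0 < p'" "1 / p + 1 / p' = 1" using p by (auto simp: p'_def field_simps)
  have q: "0 < q" using p pq by simp
  \<comment> \<open>The exponents of the kernel after the weights of both spaces have been moved
    into it. The assumptions on a and b become aa > -1/q and bb > -1/p'.\<close>
  define aa where "aa = a + be / q"
  define bb where "bb = b - al / p"
  have aa: "- 1 / q < aa" using a q by (simp add: aa_def field_simps)
  have bb: "- 1 / p' < bb"
  proof -
    have "(al + 1) / p < b + 1" using b p by (simp add: divide_less_eq mult.commute)
    then show ?thesis using p' by (simp add: bb_def add_divide_distrib)
  qed
  txt \<open>The Schur test works for any \<open>X \<in> (-1/p', b - \<alpha>/p)\<close> and \<open>Y \<in> (-1/q, a + \<beta>/q)\<close>; the splitting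
    \<open>c = c1 + c2\<close> is then forced by homogeneity.\<close>
  define X where "X = (bb - 1 / p') / 2"
  define Y where "Y = (aa - 1 / q) / 2"
  have X: "- 1 / p' < X" "X < bb" using bb by (auto simp: X_def)
  have Y: "- 1 / q < Y" "Y < aa" using aa by (auto simp: Y_def)
  define c1 where "c1 = aa - Y + X + (n + 1) / p'"
  define c2 where "c2 = bb - X + Y + (n + 1) / q"
  have c12: "c1 + c2 = c"
  proof -
    have "1 / p' = 1 - 1 / p" using p' by simp
    then have "(n + 1) / p' = (n + 1) * (1 - 1 / p)" by (metis times_divide_eq_right mult.right_neutral)
    then show ?thesis by (simp add: c1_def c2_def c aa_def bb_def add_divide_distrib algebra_simps)
  qed
  have c12': "- c1 - c2 = - c" using c12 by simp
  \<comment> \<open>With this c1 the resulting power of rho(z) is that of h(z)^p', and the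
    hypothesis of the Forelli--Rudin estimate reduces to Y < aa.\<close>
  obtain C1 where C1: "0 \<le> C1" "\<And>z. z \<in> TB e \<Longrightarrow>
      (\<integral>\<^sup>+u. indicator (TB e) u * ennreal (tb_rho e u powr (p' * X) * cmod (tb_rho2 e z u) powr (-(p' * c1))) \<partial>lborel)
      \<le> ennreal (C1 * tb_rho e z powr (n + 1 + p' * X - p' * c1))"
  proof (rule Forelli_Rudin[of "p' * X" "p' * c1" e])
    show "- 1 < p' * X" using X p' by (simp add: field_simps)
    have "n + 1 + p' * X < p' * (aa - Y) + p' * X + (n + 1)" using Y p' by simp
    also have "\<dots> = p' * c1" using p' by (simp add: c1_def field_simps)
    finally show "real CARD('n) + 1 + p' * X < p' * c1" by (simp add: n_def)
  qed (use that in \<open>auto simp: n_def\<close>)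
  \<comment> \<open>The same with z and u exchanged: c2 produces the power of rho(u) that cancels
    the factor left in k2, and the hypothesis reduces to X < bb.\<close>
  obtain C2 where C2: "0 \<le> C2" "\<And>u. u \<in> TB e \<Longrightarrow>
      (\<integral>\<^sup>+z. indicator (TB e) z * ennreal (tb_rho e z powr (q * Y) * cmod (tb_rho2 e u z) powr (-(q * c2))) \<partial>lborel)
      \<le> ennreal (C2 * tb_rho e u powr (n + 1 + q * Y - q * c2))"
  proof (rule Forelli_Rudin[of "q * Y" "q * c2" e])
    show "- 1 < q * Y" using Y q by (simp add: field_simps)
    have "n + 1 + q * Y < q * (bb - X) + q * Y + (n + 1)" using X q by simp
    also have "\<dots> = q * c2" using q by (simp add: c2_def field_simps)
    finally show "real CARD('n) + 1 + q * Y < q * c2" by (simp add: n_def)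
  qed (use that in \<open>auto simp: n_def\<close>)
  define k1 where "k1 z u = indicator (TB e) z * indicator (TB e) u *
    ennreal (tb_rho e u powr X * cmod (tb_rho2 e z u) powr (-c1))" for z u
  define k2 where "k2 z u = indicator (TB e) z * indicator (TB e) u *
    ennreal (tb_rho e z powr aa * tb_rho e u powr (bb - X) * cmod (tb_rho2 e z u) powr (-c2))" for z u
  \<comment> \<open>The Schur weight; multiplied by k2 it leaves rho(z)^Y.\<close>
  define h where "h z = indicator (TB e) z * ennreal (tb_rho e z powr (Y - aa))" for z
  have pos: "0 < cmod (tb_rho2 e z u)" "0 < tb_rho e z" "0 < tb_rho e u" if "z \<in> TB e" "u \<in> TB e" for z u
    using Re_tb_rho2_pos[OF that] that by (auto simp: TB_def)
  have k1: "(\<integral>\<^sup>+u. ennpow (k1 z u) p' \<partial>lborel) \<le> ennreal C1 * ennpow (h z) p'" for z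
  proof (cases "z \<in> TB e")
    case True
    have "(\<integral>\<^sup>+u. ennpow (k1 z u) p' \<partial>lborel)
      = (\<integral>\<^sup>+u. indicator (TB e) u * ennreal (tb_rho e u powr (p' * X) * cmod (tb_rho2 e z u) powr (-(p' * c1))) \<partial>lborel)"
      using True by (intro nn_integral_cong)
        (auto simp: k1_def ennpow_ennreal powr_mult powr_powr mult.commute split: split_indicator)
    also have "\<dots> \<le> ennreal (C1 * tb_rho e z powr (n + 1 + p' * X - p' * c1))" by (rule C1(2)[OF True])
    also have "n + 1 + p' * X - p' * c1 = (Y - aa) * p'"
      using p' by (simp add: c1_def field_simps)
    also have "ennreal (C1 * tb_rho e z powr ((Y - aa) * p')) = ennreal C1 * ennpow (h z) p'"
      using True C1(1) by (simp add: h_def ennpow_ennreal powr_powr ennreal_mult)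
    finally show ?thesis .
  qed (simp add: k1_def)
  have k2: "(\<integral>\<^sup>+z. ennpow (h z * k2 z u) q \<partial>lborel) \<le> ennreal C2" for u
  proof (cases "u \<in> TB e")
    case True
    have eq: "ennpow (h z * k2 z u) q = ennreal (tb_rho e u powr ((bb - X) * q)) *
       (indicator (TB e) z * ennreal (tb_rho e z powr (q * Y) * cmod (tb_rho2 e u z) powr (-(q * c2))))" for z
    proof (cases "z \<in> TB e")
      case z: True
      have "h z * k2 z u = ennreal (tb_rho e z powr Y * tb_rho e u powr (bb - X) * cmod (tb_rho2 e u z) powr (-c2))"
        using True z pos[OF z True] by (simp add: h_def k2_def ennreal_mult[symmetric] powr_diff cmod_tb_rho2_commute[of e u z])
      then show ?thesis using z
        by (simp add: ennpow_ennreal powr_mult powr_powr ennreal_mult[symmetric] mult_ac)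
    qed (simp add: h_def)
    have "(\<integral>\<^sup>+z. ennpow (h z * k2 z u) q \<partial>lborel) = ennreal (tb_rho e u powr ((bb - X) * q)) *
       (\<integral>\<^sup>+z. indicator (TB e) z * ennreal (tb_rho e z powr (q * Y) * cmod (tb_rho2 e u z) powr (-(q * c2))) \<partial>lborel)"
      unfolding eq by (intro nn_integral_cmult) measurable
    also have "\<dots> \<le> ennreal (tb_rho e u powr ((bb - X) * q)) * ennreal (C2 * tb_rho e u powr (n + 1 + q * Y - q * c2))"
      by (intro mult_left_mono C2(2) True) auto
    also have "n + 1 + q * Y - q * c2 = - ((bb - X) * q)"
      using q by (simp add: c2_def field_simps)
    also have "ennreal (tb_rho e u powr ((bb - X) * q)) * ennreal (C2 * tb_rho e u powr - ((bb - X) * q)) = ennreal C2"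
      using C2(1) pos[OF True True] by (simp add: ennreal_mult[symmetric] powr_minus)
    finally show ?thesis .
  qed (simp add: k2_def)
  have [measurable]: "(\<lambda>(z, u). k1 z u) \<in> borel_measurable (lborel \<Otimes>\<^sub>M lborel)"
      "(\<lambda>(z, u). k2 z u) \<in> borel_measurable (lborel \<Otimes>\<^sub>M lborel)" "h \<in> borel_measurable borel"
    unfolding k1_def k2_def h_def by measurable
  have "wnorm e q be (kint e (kern1 e a b c) f)
     \<le> ennreal (C1 powr (1 / p') * C2 powr (1 / q)) * wnorm e p al f" if [measurable]: "f \<in> borel_measurable borel" for f
  proof -
    define F where "F u = indicator (TB e) u * ennreal (tb_rho e u powr (al / p)) * f u" for u
    have [measurable]: "F \<in> borel_measurable borel" unfolding F_def by measurable
    have kk: "k1 z u * k2 z u * F u = (indicator (TB e) z * ennreal (tb_rho e z powr (be / q)))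
        * (indicator (TB e) u * kern1 e a b c z u * f u)" for z u
    proof (cases "z \<in> TB e \<and> u \<in> TB e")
      case True
      have "tb_rho e u powr X * cmod (tb_rho2 e z u) powr (-c1)
          * (tb_rho e z powr aa * tb_rho e u powr (bb - X) * cmod (tb_rho2 e z u) powr (-c2)) * tb_rho e u powr (al / p)
        = tb_rho e z powr aa * (tb_rho e u powr X * tb_rho e u powr (bb - X) * tb_rho e u powr (al / p)) *
          (cmod (tb_rho2 e z u) powr (-c1) * cmod (tb_rho2 e z u) powr (-c2))"
        by (simp only: mult_ac)
      also have "\<dots> = tb_rho e z powr (be / q + a) * tb_rho e u powr b * cmod (tb_rho2 e z u) powr (-c)"
        unfolding c12'[symmetric] by (simp add: powr_add[symmetric] aa_def bb_def add.commute)
      finally have "tb_rho e u powr X * cmod (tb_rho2 e z u) powr (-c1)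
          * (tb_rho e z powr aa * tb_rho e u powr (bb - X) * cmod (tb_rho2 e z u) powr (-c2)) * tb_rho e u powr (al / p)
         = tb_rho e z powr (be / q) * (tb_rho e z powr a * tb_rho e u powr b * cmod (tb_rho2 e z u) powr (-c))"
        by (simp add: powr_add mult.assoc)
      from arg_cong[OF this, of "\<lambda>x. ennreal x * f u"] show ?thesis using True
        by (simp add: k1_def k2_def F_def kern1_def ennreal_mult mult.assoc)
    qed (auto simp: k1_def F_def)
    have "wnorm e q be (kint e (kern1 e a b c) f)
       = ennpow (\<integral>\<^sup>+z. ennpow (\<integral>\<^sup>+u. k1 z u * k2 z u * F u \<partial>lborel) q \<partial>lborel) (1 / q)"
    proof -
      have "ennpow (\<integral>\<^sup>+u. k1 z u * k2 z u * F u \<partial>lborel) q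
        = indicator (TB e) z * ennpow (kint e (kern1 e a b c) f z) q * ennreal (tb_rho e z powr be)" for z
      proof -
        have "(\<integral>\<^sup>+u. k1 z u * k2 z u * F u \<partial>lborel)
            = (indicator (TB e) z * ennreal (tb_rho e z powr (be / q))) * kint e (kern1 e a b c) f z"
          unfolding kk kint_def by (intro nn_integral_cmult) measurable
        then show ?thesis using q
          by (auto simp: ennpow_mult ennpow_ennreal powr_powr mult_ac split: split_indicator)
      qed
      then show ?thesis by (simp add: wnorm_def)
    qed
    also have "\<dots> \<le> ennpow (ennreal C1) (1 / p') * ennpow (ennreal C2) (1 / q) * ennpow (\<integral>\<^sup>+u. ennpow (F u) p \<partial>lborel) (1 / p)"
      by (rule Schur_test[OF sigma_finite_lborel sigma_finite_lborel _ _ _ _ p pq p'(2) k1 k2]) measurable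
    also have "ennpow (\<integral>\<^sup>+u. ennpow (F u) p \<partial>lborel) (1 / p) = wnorm e p al f"
      unfolding wnorm_def F_def using p
      by (intro arg_cong[of _ _ "\<lambda>x. ennpow x _"] nn_integral_cong)
         (auto simp: ennpow_mult ennpow_ennreal powr_powr mult_ac split: split_indicator)
    finally show ?thesis using C1 C2 by (simp add: ennpow_ennreal ennreal_mult)
  qed
  then show thesis using that[of "C1 powr (1 / p') * C2 powr (1 / q)"] by simp
qed

section \<open>Mixed norms\<close>

lemma borel_measurable_kint [measurable]:
  assumes [measurable]: "(\<lambda>(z, u). k z u) \<in> borel_measurable (borel \<Otimes>\<^sub>M borel)"
    "(\<lambda>(x, u). f x u) \<in> borel_measurable (M \<Otimes>\<^sub>M borel)" "g \<in> borel_measurable M"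
  shows "(\<lambda>x. kint e k (f x) (g x)) \<in> borel_measurable M"
proof -
  have [measurable]: "(\<lambda>(x, u). f x u) \<in> borel_measurable (M \<Otimes>\<^sub>M lborel)"
    using assms(2) by (simp cong: measurable_cong_sets sets_pair_measure_cong)
  show ?thesis unfolding kint_def by measurable
qed

definition kint2 :: "'n::finite \<Rightarrow> (complex^'n \<Rightarrow> complex^'n \<Rightarrow> ennreal) \<Rightarrow> (complex^'n \<Rightarrow> complex^'n \<Rightarrow> ennreal)
    \<Rightarrow> ((complex^'n) \<times> (complex^'n) \<Rightarrow> ennreal) \<Rightarrow> (complex^'n) \<times> (complex^'n) \<Rightarrow> ennreal" where
  "kint2 e k1 k2 F x = (\<integral>\<^sup>+y. indicator (TB e \<times> TB e) y * (k1 (fst x) (fst y) * k2 (snd x) (snd y)) * F y \<partial>(lborel \<Otimes>\<^sub>M lborel))"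

lemma kint2_iterated:
  assumes [measurable]: "(\<lambda>(z, u). k1 z u) \<in> borel_measurable (borel \<Otimes>\<^sub>M borel)"
    "(\<lambda>(z, u). k2 z u) \<in> borel_measurable (borel \<Otimes>\<^sub>M borel)" "F \<in> borel_measurable (borel \<Otimes>\<^sub>M borel)"
  shows "kint2 e k1 k2 F (z, w) =
    (\<integral>\<^sup>+\<eta>. (indicator (TB e) \<eta> * k2 w \<eta>) * kint e k1 (\<lambda>u. F (u, \<eta>)) z \<partial>lborel)"
proof -
  have [measurable]: "(\<lambda>u. k1 z u) \<in> borel_measurable borel" "(\<lambda>u. k2 w u) \<in> borel_measurable borel" for z w
    by measurable
  have [measurable]: "(\<lambda>u. F (u, \<eta>)) \<in> borel_measurable borel" for \<eta> by measurable
  define G where "G y = indicator (TB e \<times> TB e) y * (k1 z (fst y) * k2 w (snd y)) * F y" for y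
  have [measurable]: "G \<in> borel_measurable (lborel \<Otimes>\<^sub>M lborel)"
    unfolding G_def indicator_times by measurable
  have "kint2 e k1 k2 F (z, w) = integral\<^sup>N (lborel \<Otimes>\<^sub>M lborel) G"
    by (simp add: kint2_def G_def[abs_def])
  also have "\<dots> = (\<integral>\<^sup>+\<eta>. (\<integral>\<^sup>+u. G (u, \<eta>) \<partial>lborel) \<partial>lborel)"
    by (rule lborel_pair.nn_integral_snd[symmetric]) measurable
  also have "\<dots> = (\<integral>\<^sup>+\<eta>. (indicator (TB e) \<eta> * k2 w \<eta>) * kint e k1 (\<lambda>u. F (u, \<eta>)) z \<partial>lborel)"
  proof (rule nn_integral_cong)
    fix \<eta>
    have "(\<integral>\<^sup>+u. G (u, \<eta>) \<partial>lborel) = (\<integral>\<^sup>+u. (indicator (TB e) \<eta> * k2 w \<eta>) * (indicator (TB e) u * k1 z u * F (u, \<eta>)) \<partial>lborel)"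
      by (intro nn_integral_cong) (auto simp: G_def indicator_times mult_ac)
    also have "\<dots> = (indicator (TB e) \<eta> * k2 w \<eta>) * kint e k1 (\<lambda>u. F (u, \<eta>)) z"
      unfolding kint_def by (intro nn_integral_cmult) measurable
    finally show "(\<integral>\<^sup>+u. G (u, \<eta>) \<partial>lborel) = (indicator (TB e) \<eta> * k2 w \<eta>) * kint e k1 (\<lambda>u. F (u, \<eta>)) z" .
  qed
  finally show ?thesis .
qed

text \<open>For fixed w the inner norm in z is taken under the integral over \<eta>, where the first
  operator acts on the slice F(., \<eta>). What remains is the second operator applied to the slice
  norms g(\<eta>), and the outer norm of g is the mixed norm of F.\<close>

lemma kint2_bounded:
  fixes e :: "'n::finite"
  assumes [measurable]: "(\<lambda>(z, u). k1 z u) \<in> borel_measurable (borel \<Otimes>\<^sub>M borel)"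
    "(\<lambda>(z, u). k2 z u) \<in> borel_measurable (borel \<Otimes>\<^sub>M borel)"
    "F \<in> borel_measurable (borel \<Otimes>\<^sub>M borel)"
    and q: "1 \<le> q1" "0 < q2"
    and k1: "\<And>f. f \<in> borel_measurable borel \<Longrightarrow> wnorm e q1 be1 (kint e k1 f) \<le> C1 * wnorm e p1 al1 f"
    and k2: "\<And>f. f \<in> borel_measurable borel \<Longrightarrow> wnorm e q2 be2 (kint e k2 f) \<le> C2 * wnorm e p2 al2 f"
  shows "wnorm e q2 be2 (\<lambda>w. wnorm e q1 be1 (\<lambda>z. kint2 e k1 k2 F (z, w)))
     \<le> C1 * C2 * wnorm e p2 al2 (\<lambda>w. wnorm e p1 al1 (\<lambda>z. F (z, w)))"
proof -
  have [measurable]: "(\<lambda>u. k2 w u) \<in> borel_measurable borel" for w by measurable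
  have Fm [measurable]: "(\<lambda>u. F (u, \<eta>)) \<in> borel_measurable borel" for \<eta> by measurable
  define g where "g \<eta> = wnorm e p1 al1 (\<lambda>u. F (u, \<eta>))" for \<eta>
  have [measurable]: "g \<in> borel_measurable borel" unfolding g_def by measurable
  have inner: "wnorm e q1 be1 (\<lambda>z. kint2 e k1 k2 F (z, w)) \<le> C1 * kint e k2 g w" for w
  proof -
    have "wnorm e q1 be1 (\<lambda>z. kint2 e k1 k2 F (z, w))
       = wnorm e q1 be1 (\<lambda>z. \<integral>\<^sup>+\<eta>. (indicator (TB e) \<eta> * k2 w \<eta>) * kint e k1 (\<lambda>u. F (u, \<eta>)) z \<partial>lborel)"
      by (simp add: kint2_iterated)
    also have "\<dots> \<le> (\<integral>\<^sup>+\<eta>. wnorm e q1 be1 (\<lambda>z. (indicator (TB e) \<eta> * k2 w \<eta>) * kint e k1 (\<lambda>u. F (u, \<eta>)) z) \<partial>lborel)"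
      using q by (intro wnorm_Minkowski) measurable
    also have "\<dots> = (\<integral>\<^sup>+\<eta>. (indicator (TB e) \<eta> * k2 w \<eta>) * wnorm e q1 be1 (kint e k1 (\<lambda>u. F (u, \<eta>))) \<partial>lborel)"
      using q by (intro nn_integral_cong wnorm_cmult) auto
    also have "\<dots> \<le> (\<integral>\<^sup>+\<eta>. (indicator (TB e) \<eta> * k2 w \<eta>) * (C1 * g \<eta>) \<partial>lborel)"
      unfolding g_def by (intro nn_integral_mono mult_left_mono k1) auto
    also have "\<dots> = (\<integral>\<^sup>+\<eta>. C1 * (indicator (TB e) \<eta> * k2 w \<eta> * g \<eta>) \<partial>lborel)"
      by (simp add: mult_ac)
    also have "\<dots> = C1 * kint e k2 g w"
      unfolding kint_def by (intro nn_integral_cmult) measurable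
    finally show ?thesis .
  qed
  have "wnorm e q2 be2 (\<lambda>w. wnorm e q1 be1 (\<lambda>z. kint2 e k1 k2 F (z, w))) \<le> wnorm e q2 be2 (\<lambda>w. C1 * kint e k2 g w)"
    by (intro wnorm_mono inner q)
  also have "\<dots> = C1 * wnorm e q2 be2 (kint e k2 g)"
    using q by (intro wnorm_cmult) auto
  also have "\<dots> \<le> C1 * (C2 * wnorm e p2 al2 g)"
    by (intro mult_left_mono k2) auto
  finally show ?thesis by (simp add: g_def[abs_def] mult.assoc)
qed

text \<open>The weight is positive on the domain, so it cannot hide an infinite value of f.\<close>

lemma wnorm_finite_AE:
  assumes [measurable]: "f \<in> borel_measurable borel" and "wnorm e p al f < top"
  shows "AE z in lborel. z \<in> TB e \<longrightarrow> f z < top"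
proof -
  have "(\<integral>\<^sup>+z. indicator (TB e) z * ennpow (f z) p * ennreal (tb_rho e z powr al) \<partial>lborel) \<noteq> \<infinity>"
    using assms(2) unfolding wnorm_def ennpow_less_top_iff by auto
  then have "AE z in lborel. indicator (TB e) z * ennpow (f z) p * ennreal (tb_rho e z powr al) \<noteq> \<infinity>"
    by (intro nn_integral_noteq_infinite) auto
  then show ?thesis
  proof eventually_elim
    case (elim z)
    show ?case
    proof
      assume z: "z \<in> TB e"
      then have "0 < tb_rho e z" by (simp add: TB_def)
      with elim z show "f z < top"
        by (cases "f z = top") (auto simp: ennreal_top_mult ennreal_mult_eq_top_iff less_top)
    qed
  qed
qed

text \<open>S is the integral of the absolute values. The two one-variable bounds control its mixed
  norm; finiteness of this norm makes S finite almost everywhere, which is the convergence of the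
  defining integral, and |\<open>kop\<close>| <= S gives the norm estimate.\<close>

lemma bounded_kop_of_kern1_bounded:
  fixes e :: "'n::finite"
  assumes Km: "\<And>x. x \<in> TB e \<times> TB e \<Longrightarrow>
      (\<lambda>y. indicator (TB e \<times> TB e) y *\<^sub>R K x y) \<in> borel_measurable (lborel \<Otimes>\<^sub>M lborel)"
    and K: "\<And>x y. x \<in> TB e \<times> TB e \<Longrightarrow> y \<in> TB e \<times> TB e \<Longrightarrow>
      ennreal (cmod (K x y)) = kern1 e (fst a) (fst b) (fst c) (fst x) (fst y) * kern1 e (snd a) (snd b) (snd c) (snd x) (snd y)"
    and p: "0 < fst p" "0 < snd p" and q: "1 \<le> fst q" "1 \<le> snd q" and C: "0 \<le> C1" "0 \<le> C2"
    and k1: "\<And>f. f \<in> borel_measurable borel \<Longrightarrow>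
      wnorm e (fst q) (fst be) (kint e (kern1 e (fst a) (fst b) (fst c)) f) \<le> ennreal C1 * wnorm e (fst p) (fst al) f"
    and k2: "\<And>f. f \<in> borel_measurable borel \<Longrightarrow>
      wnorm e (snd q) (snd be) (kint e (kern1 e (snd a) (snd b) (snd c)) f) \<le> ennreal C2 * wnorm e (snd p) (snd al) f"
  shows "bounded_kop e K p al q be"
  unfolding bounded_kop_def
proof (intro exI[of _ "C1 * C2"] allI impI conjI)
  fix f :: "(complex^'n) \<times> (complex^'n) \<Rightarrow> complex"
  assume f [measurable]: "f \<in> borel_measurable (lborel \<Otimes>\<^sub>M lborel)" and fin: "mixnorm e p al f < \<infinity>"
  define F where "F y = ennreal (cmod (f y))" for y
  let ?k1 = "kern1 e (fst a) (fst b) (fst c)" and ?k2 = "kern1 e (snd a) (snd b) (snd c)"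
  define S where "S = kint2 e ?k1 ?k2 F"
  have F [measurable]: "F \<in> borel_measurable (borel \<Otimes>\<^sub>M borel)"
    using f unfolding F_def by (simp cong: measurable_cong_sets sets_pair_measure_cong)
  have bound: "wnorm e (snd q) (snd be) (\<lambda>w. wnorm e (fst q) (fst be) (\<lambda>z. S (z, w))) \<le> ennreal (C1 * C2) * mixnorm e p al f"
    unfolding S_def mixnorm_eq_wnorm[OF p] ennreal_mult[OF C] F_def[symmetric]
    using q by (intro kint2_bounded k1 k2) auto
  have S_eq: "(\<integral>\<^sup>+y. ennreal (cmod (indicator (TB e \<times> TB e) y *\<^sub>R (K x y * f y))) \<partial>(lborel \<Otimes>\<^sub>M lborel)) = S x"
    if "x \<in> TB e \<times> TB e" for x
    unfolding S_def kint2_def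
    by (intro nn_integral_cong) (auto simp: F_def norm_mult ennreal_mult K[OF that, symmetric] split: split_indicator)
  have SI: "(S x < top) \<longrightarrow> set_integrable (lborel \<Otimes>\<^sub>M lborel) (TB e \<times> TB e) (\<lambda>y. K x y * f y)"
    if "x \<in> TB e \<times> TB e" for x
  proof
    assume "S x < top"
    have "(\<lambda>y. (indicator (TB e \<times> TB e) y *\<^sub>R K x y) * f y) \<in> borel_measurable (lborel \<Otimes>\<^sub>M lborel)"
      using Km[OF that] f by (rule borel_measurable_times)
    then show "set_integrable (lborel \<Otimes>\<^sub>M lborel) (TB e \<times> TB e) (\<lambda>y. K x y * f y)"
      unfolding set_integrable_def integrable_iff_bounded S_eq[OF that] using \<open>S x < top\<close> by simp
  qed
  have Sm [measurable]: "S \<in> borel_measurable (borel \<Otimes>\<^sub>M borel)"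
  proof -
    have "(\<lambda>(z, w). S (z, w)) \<in> borel_measurable (borel \<Otimes>\<^sub>M borel)"
      unfolding S_def by (subst kint2_iterated) measurable
    then show ?thesis by simp
  qed
  have "ennreal (C1 * C2) * mixnorm e p al f < top"
    using fin by (simp add: ennreal_mult_less_top)
  with bound have fin2: "wnorm e (snd q) (snd be) (\<lambda>w. wnorm e (fst q) (fst be) (\<lambda>z. S (z, w))) < top"
    by (rule le_less_trans)
  have "AE w in lborel. w \<in> TB e \<longrightarrow> wnorm e (fst q) (fst be) (\<lambda>z. S (z, w)) < top"
    by (rule wnorm_finite_AE[OF _ fin2]) measurable
  then have "AE w in lborel. AE z in lborel. z \<in> TB e \<longrightarrow> w \<in> TB e \<longrightarrow> S (z, w) < top"
  proof eventually_elim
    case (elim w)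
    show ?case
    proof (cases "w \<in> TB e")
      case True
      with elim have fin: "wnorm e (fst q) (fst be) (\<lambda>z. S (z, w)) < top" by simp
      have "AE z in lborel. z \<in> TB e \<longrightarrow> S (z, w) < top"
        by (rule wnorm_finite_AE[OF _ fin]) measurable
      then show ?thesis by eventually_elim simp
    qed simp
  qed
  \<comment> \<open>The nested norms give finiteness for almost every w and then almost every z; the
    order is exchanged to reach the product measure.\<close>
  then have "AE z in lborel. AE w in lborel. z \<in> TB e \<longrightarrow> w \<in> TB e \<longrightarrow> S (z, w) < top"
    by (subst lborel_pair.AE_commute) measurable
  then have "AE x in lborel \<Otimes>\<^sub>M lborel. fst x \<in> TB e \<longrightarrow> snd x \<in> TB e \<longrightarrow> S (fst x, snd x) < top"
    by (subst lborel_pair.AE_pair_iff[symmetric]) measurable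
  then show "AE x in lborel \<Otimes>\<^sub>M lborel. x \<in> TB e \<times> TB e \<longrightarrow>
      set_integrable (lborel \<Otimes>\<^sub>M lborel) (TB e \<times> TB e) (\<lambda>y. K x y * f y)"
  proof eventually_elim
    case (elim x)
    then show ?case using SI[of x] by (cases x) auto
  qed
  have kop_le: "ennreal (cmod (kop e K f x)) \<le> S x" if x: "x \<in> TB e \<times> TB e" for x
  proof (cases "S x < top")
    case True
    with SI[OF x] have "integrable (lborel \<Otimes>\<^sub>M lborel) (\<lambda>y. indicator (TB e \<times> TB e) y *\<^sub>R (K x y * f y))"
      by (simp add: set_integrable_def)
    from integral_norm_bound_ennreal[OF this] show ?thesis
      unfolding S_eq[OF x] by (simp add: kop_def set_lebesgue_integral_def)
  next
    case False
    then have "S x = top" by (simp add: not_less top_unique)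
    then show ?thesis by simp
  qed
  have "mixnorm e q be (kop e K f) = wnorm e (snd q) (snd be) (\<lambda>w. wnorm e (fst q) (fst be) (\<lambda>z. ennreal (cmod (kop e K f (z, w)))))"
    using q by (intro mixnorm_eq_wnorm) auto
  also have "\<dots> \<le> wnorm e (snd q) (snd be) (\<lambda>w. wnorm e (fst q) (fst be) (\<lambda>z. S (z, w)))"
    using q by (intro wnorm_mono kop_le) auto
  also note bound
  finally show "mixnorm e q be (kop e K f) \<le> ennreal (C1 * C2) * mixnorm e p al f" .
qed

section \<open>Test sets\<close>

text \<open>Used with A = \<epsilon> sqrt R and B = \<epsilon> R, the natural scale of the domain; l
  and h alone decide how near to the boundary the set lies. For l > 0 it is compact in the domain,
  so continuous functions are integrable over it.\<close>

definition tset :: "'n::finite \<Rightarrow> real \<Rightarrow> real \<Rightarrow> real \<Rightarrow> real \<Rightarrow> (complex^'n) set" where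
  "tset e A B l h = {u. u \<in> tbox e 0 A \<and> \<bar>Re (u$e)\<bar> \<le> B \<and> l \<le> tb_rho e u \<and> tb_rho e u \<le> h}"

lemma tset_subset_TB: "0 < l \<Longrightarrow> tset e A B l h \<subseteq> TB e"
  by (auto simp: tset_def TB_def)

lemma compact_tset:
  fixes e :: "'n::finite"
  assumes "0 \<le> A" "0 < l"
  shows "compact (tset e A B l h)"
proof -
  have "closed (tbox e 0 A)"
    unfolding tbox_def
  proof (intro closed_Collect_all)
    fix j
    show "closed {u. j \<noteq> e \<longrightarrow> \<bar>Re (u$j - 0$j)\<bar> \<le> A \<and> \<bar>Im (u$j - 0$j)\<bar> \<le> A}"
      by (cases "j = e") (auto intro!: closed_Collect_conj closed_Collect_le continuous_intros)
  qed
  moreover have "closed {u. \<bar>Re (u$e)\<bar> \<le> B \<and> l \<le> tb_rho e u \<and> tb_rho e u \<le> h}"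
    by (intro closed_Collect_conj closed_Collect_le continuous_intros)
  ultimately have "closed (tset e A B l h)"
    unfolding tset_def Collect_conj_eq by (auto intro: closed_Int)
  moreover have "bounded (tset e A B l h)"
  proof -
    \<comment> \<open>The last two terms bound Im u_n, which is rho(u) plus |Im u'|^2.\<close>
    define M where "M = A + \<bar>B\<bar> + \<bar>h\<bar> + CARD('n) * A\<^sup>2"
    have "tset e A B l h \<subseteq> cbox (\<Sum>b\<in>Basis. (- M) *\<^sub>R b) (\<Sum>b\<in>Basis. M *\<^sub>R b)"
    proof
      fix u assume u: "u \<in> tset e A B l h"
      have M: "A \<le> M" "\<bar>B\<bar> \<le> M" "\<bar>h\<bar> + CARD('n) * A\<^sup>2 \<le> M" using assms by (auto simp: M_def)
      have "(\<Sum>j\<in>UNIV-{e}. (Im (u$j))\<^sup>2) \<le> (\<Sum>j\<in>UNIV-{e}. A\<^sup>2)"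
        using u by (intro sum_mono abs_le_square_iff[THEN iffD1]) (auto simp: tset_def tbox_def assms)
      also have "\<dots> \<le> (\<Sum>j\<in>(UNIV::'n set). A\<^sup>2)" by (intro sum_mono2) auto
      finally have s: "(\<Sum>j\<in>UNIV-{e}. (Im (u$j))\<^sup>2) \<le> CARD('n) * A\<^sup>2" by simp
      have s0: "0 \<le> (\<Sum>j\<in>UNIV-{e}. (Im (u$j))\<^sup>2)" by (intro sum_nonneg) auto
      have "l \<le> Im (u$e) - (\<Sum>j\<in>UNIV-{e}. (Im (u$j))\<^sup>2)" "Im (u$e) - (\<Sum>j\<in>UNIV-{e}. (Im (u$j))\<^sup>2) \<le> h"
        using u by (auto simp: tset_def tb_rho_def)
      with s s0 assms have "\<bar>Im (u$e)\<bar> \<le> \<bar>h\<bar> + CARD('n) * A\<^sup>2" by linarith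
      with M have Ie: "\<bar>Im (u$e)\<bar> \<le> M" by linarith
      have Re: "\<bar>Re (u$e)\<bar> \<le> M" using u M by (auto simp: tset_def)
      have all: "\<bar>Re (u$j)\<bar> \<le> M \<and> \<bar>Im (u$j)\<bar> \<le> M" for j
      proof (cases "j = e")
        case False
        then have "\<bar>Re (u$j)\<bar> \<le> A \<and> \<bar>Im (u$j)\<bar> \<le> A" using u by (auto simp: tset_def tbox_def)
        with M show ?thesis by linarith
      qed (use Ie Re in auto)
      show "u \<in> cbox (\<Sum>b\<in>Basis. (- M) *\<^sub>R b) (\<Sum>b\<in>Basis. M *\<^sub>R b)"
      proof (unfold mem_box, intro ballI)
        fix b :: "complex^'n" assume b: "b \<in> Basis"
        then obtain j k where jk: "b = axis j k" "k = 1 \<or> k = \<i>" by (auto simp: Basis_cvec)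
        then have "\<bar>u \<bullet> b\<bar> \<le> M" using all[of j] by (auto simp: inner_axis)
        then show "(\<Sum>b\<in>Basis. (- M) *\<^sub>R b) \<bullet> b \<le> u \<bullet> b \<and> u \<bullet> b \<le> (\<Sum>b\<in>Basis. M *\<^sub>R b) \<bullet> b"
          using b by (simp add: inner_sum_left_Basis sum_negf abs_le_iff)
      qed
    qed
    then show ?thesis by (rule bounded_subset[OF bounded_cbox])
  qed
  ultimately show ?thesis by (simp add: compact_eq_bounded_closed)
qed

lemma sets_tset [measurable]: "tset e A B l h \<in> sets borel"
  unfolding tset_def by measurable

lemma nn_integral_tset:
  fixes e :: "'n::finite" and g :: "real \<Rightarrow> ennreal"
  assumes [measurable]: "g \<in> borel_measurable borel" and eps: "0 < \<epsilon>" and R: "0 < R"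
  shows "(\<integral>\<^sup>+u. indicator (tset e (\<epsilon> * sqrt R) (\<epsilon> * R) l h) u * g (tb_rho e u) \<partial>lborel)
    = ennreal ((2 * \<epsilon>) ^ (2 * CARD('n) - 1) * R powr CARD('n)) * (\<integral>\<^sup>+t. indicator {l..h} t * g t \<partial>lborel)"
proof -
  let ?A = "\<epsilon> * sqrt R" and ?B = "\<epsilon> * R"
  have "(\<integral>\<^sup>+u. indicator (tset e ?A ?B l h) u * g (tb_rho e u) \<partial>lborel)
    = (\<integral>\<^sup>+u. indicator (tbox e 0 ?A) u * indicator {-?B..?B} (Re (u$e) - 0) * (indicator {l..h} (tb_rho e u) * g (tb_rho e u)) \<partial>lborel)"
    by (intro nn_integral_cong) (auto simp: tset_def abs_le_iff split: split_indicator)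
  also have "\<dots> = ennreal ((2 * ?A) ^ (2 * CARD('n) - 2) * (2 * ?B)) * (\<integral>\<^sup>+t. indicator {l..h} t * g t \<partial>lborel)"
    using eps R by (intro nn_integral_tbox) auto
  also have "(2 * ?A) ^ (2 * CARD('n) - 2) * (2 * ?B) = (2 * \<epsilon>) ^ (2 * CARD('n) - 1) * R powr CARD('n)"
  proof -
    obtain k where k: "CARD('n) = Suc k" using zero_less_card_finite[where 'a='n] gr0_implies_Suc by blast
    have "sqrt R ^ (2 * k) = R ^ k" using R by (simp add: power_mult)
    moreover have "R powr CARD('n) = R ^ k * R" using R powr_realpow[of R "Suc k"] by (simp only: k power_Suc2)
    moreover have "(2 * ?A) ^ (2 * CARD('n) - 2) * (2 * ?B) = (2 * \<epsilon>) ^ (2 * k) * (2 * \<epsilon>) * (sqrt R ^ (2 * k) * R)"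
      by (simp add: k power_mult_distrib)
    ultimately show ?thesis by (simp add: k)
  qed
  finally show ?thesis .
qed

text \<open>Kept as an integral because its closed form changes at s = -1, the exponent at which the
  necessity argument takes place. Scaling, monotonicity in s and the logarithm at s = -1 are all
  that is required of it.\<close>

definition pint :: "real \<Rightarrow> real \<Rightarrow> real \<Rightarrow> real" where
  "pint s l h = integral\<^sup>L lborel (\<lambda>t. indicator {l..h} t *\<^sub>R t powr s)"

lemma nn_integral_pint:
  assumes "0 < l"
  shows "(\<integral>\<^sup>+t. indicator {l..h} t * ennreal (t powr s) \<partial>lborel) = ennreal (pint s l h)"
proof -
  have "integrable lborel (\<lambda>t. indicator {l..h} t *\<^sub>R t powr s)"
    using assms by (intro borel_integrable_compact continuous_intros) auto
  then have "(\<integral>\<^sup>+t. ennreal (indicator {l..h} t *\<^sub>R t powr s) \<partial>lborel) = ennreal (pint s l h)"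
    unfolding pint_def by (intro nn_integral_eq_integral) auto
  then show ?thesis by (simp add: ennreal_mult' ennreal_indicator)
qed

lemma pint_nonneg: "0 \<le> pint s l h"
  unfolding pint_def by (intro integral_nonneg_AE) auto

lemma pint_pos:
  assumes "0 < l" "l < h"
  shows "0 < pint s l h"
proof (rule ccontr)
  assume "\<not> 0 < pint s l h"
  then have "(\<integral>\<^sup>+t. indicator {l..h} t * ennreal (t powr s) \<partial>lborel) = 0"
    using nn_integral_pint[OF assms(1)] by (simp add: ennreal_neg)
  then have "AE t in lborel. indicator {l..h} t * ennreal (t powr s) = 0"
    by (simp add: nn_integral_0_iff_AE)
  then have "AE t in lborel. t \<notin> {l..h}"
    by eventually_elim (use assms in \<open>auto split: split_indicator_asm\<close>)
  then have "emeasure lborel {l..h} = 0"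
    using emeasure_eq_AE[of "{l..h}" "{}" lborel] by simp
  then show False using assms by simp
qed

lemma pint_scale:
  assumes "0 < l" "0 < R"
  shows "pint s (R * l) (R * h) = R powr (s + 1) * pint s l h"
proof -
  have "pint s (R * l) (R * h) = R * integral\<^sup>L lborel (\<lambda>t. indicator {R * l..R * h} (0 + R * t) *\<^sub>R (0 + R * t) powr s)"
    unfolding pint_def using assms by (subst lborel_integral_real_affine[of R _ 0]) auto
  also have "(\<lambda>t. indicator {R * l..R * h} (0 + R * t) *\<^sub>R (0 + R * t) powr s) = (\<lambda>t. R powr s * (indicator {l..h} t *\<^sub>R t powr s))"
    using assms by (auto simp: fun_eq_iff powr_mult split: split_indicator)
  finally show ?thesis using assms by (simp add: pint_def powr_add)
qed

text \<open>The critical exponent: the value grows without bound as l tends to 0. Both strict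
  inequalities of (3) are drawn from this.\<close>

lemma pint_minus_one:
  assumes "0 < l" "l \<le> h"
  shows "pint (-1) l h = ln (h / l)"
proof -
  have "(\<integral>\<^sup>+t. ennreal (1 / t) * indicator {l..h} t \<partial>lborel) = ennreal (ln h - ln l)"
    using assms by (intro nn_integral_FTC_Icc) (auto intro!: derivative_eq_intros)
  also have "(\<integral>\<^sup>+t. ennreal (1 / t) * indicator {l..h} t \<partial>lborel) = (\<integral>\<^sup>+t. indicator {l..h} t * ennreal (t powr (-1)) \<partial>lborel)"
    using assms by (intro nn_integral_cong) (auto simp: powr_minus_divide split: split_indicator)
  finally have "ennreal (pint (-1) l h) = ennreal (ln h - ln l)"
    by (simp only: nn_integral_pint[OF assms(1)])
  then show ?thesis using assms pint_nonneg by (simp add: ln_div)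
qed

lemma pint_mono:
  assumes "0 < l" "h \<le> 1" "s \<le> r"
  shows "pint r l h \<le> pint s l h"
proof -
  have "ennreal (pint r l h) \<le> ennreal (pint s l h)"
    unfolding nn_integral_pint[OF assms(1), symmetric]
    using assms by (intro nn_integral_mono) (auto split: split_indicator intro!: ennreal_leI powr_mono')
  then show ?thesis using pint_nonneg by (simp add: ennreal_le_iff)
qed

text \<open>The assumptions on the heights place (rho(z) + rho(u))/2 between R/2 and R/2 +
  \<epsilon> R. The contributions of the other coordinates are errors of order \<epsilon>^2 R,
  absorbed into \<epsilon> R since \<epsilon> <= 1. Real and imaginary part are each off by at most
  (2n + 1) \<epsilon> R, whence the factor 2.\<close>

lemma tb_rho2_near_half:
  fixes e :: "'n::finite" and \<epsilon> R :: real
  assumes eps: "0 < \<epsilon>" "\<epsilon> \<le> 1" and R: "0 < R"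
    and z: "z \<in> tset e (\<epsilon> * sqrt R) (\<epsilon> * R) l1 h1" and u: "u \<in> tset e (\<epsilon> * sqrt R) (\<epsilon> * R) l2 h2"
    and l: "l1 + l2 \<ge> R" and h: "h1 + h2 \<le> (1 + 2 * \<epsilon>) * R"
  shows "cmod (tb_rho2 e z u / of_real R - 1 / 2) \<le> 2 * (2 * real CARD('n) + 1) * \<epsilon>"
proof -
  let ?A = "\<epsilon> * sqrt R"
  have A2: "?A * ?A = \<epsilon> * \<epsilon> * R" using R by (simp add: algebra_simps)
  have ee: "\<epsilon> * \<epsilon> * R \<le> \<epsilon> * R" using eps R by (simp add: mult_left_le)
  have zu: "\<bar>Re (z$j)\<bar> \<le> ?A" "\<bar>Im (z$j)\<bar> \<le> ?A" "\<bar>Re (u$j)\<bar> \<le> ?A" "\<bar>Im (u$j)\<bar> \<le> ?A" if "j \<noteq> e" for j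
    using z u that by (auto simp: tset_def tbox_def)
  have card: "real (card (UNIV - {e})) \<le> real CARD('n)" by (simp add: card_mono)
  have bnd: "(\<Sum>j\<in>UNIV-{e}. f j) \<le> real CARD('n) * K" if "\<And>j. j \<noteq> e \<Longrightarrow> f j \<le> K" "0 \<le> K" for f and K :: real
  proof -
    have "(\<Sum>j\<in>UNIV-{e}. f j) \<le> real (card (UNIV - {e})) * K"
      using sum_bounded_above[of "UNIV-{e}" f K] that by auto
    also have "\<dots> \<le> real CARD('n) * K" using card that(2) by (intro mult_right_mono) auto
    finally show ?thesis .
  qed
  have sqle: "(x - y)\<^sup>2 \<le> 4 * (\<epsilon> * R)" if "\<bar>x\<bar> \<le> ?A" "\<bar>y\<bar> \<le> ?A" for x y
  proof -
    have "\<bar>x - y\<bar> \<le> 2 * ?A" using that by linarith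
    then have "(x - y)\<^sup>2 \<le> (2 * ?A)\<^sup>2" using eps R by (intro abs_le_square_iff[THEN iffD1]) auto
    also have "\<dots> = 4 * (?A * ?A)" by (simp add: power2_eq_square)
    also have "\<dots> \<le> 4 * (\<epsilon> * R)" unfolding A2 using ee by simp
    finally show ?thesis .
  qed
  let ?\<Sigma> = "\<Sum>j\<in>UNIV-{e}. (Re (z$j) - Re (u$j))\<^sup>2 + (Im (z$j) - Im (u$j))\<^sup>2"
  have S1: "?\<Sigma> \<le> real CARD('n) * (8 * (\<epsilon> * R))"
  proof (rule bnd)
    fix j assume "j \<noteq> e"
    note zu[OF this]
    then show "(Re (z$j) - Re (u$j))\<^sup>2 + (Im (z$j) - Im (u$j))\<^sup>2 \<le> 8 * (\<epsilon> * R)"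
      using sqle[of "Re (z$j)" "Re (u$j)"] sqle[of "Im (z$j)" "Im (u$j)"] by linarith
  qed (use eps R in auto)
  have S0: "0 \<le> ?\<Sigma>" by (intro sum_nonneg) auto
  let ?\<Theta> = "\<Sum>j\<in>UNIV-{e}. (Re (z$j) - Re (u$j)) * (Im (z$j) + Im (u$j))"
  have "\<bar>?\<Theta>\<bar> \<le> (\<Sum>j\<in>UNIV-{e}. \<bar>(Re (z$j) - Re (u$j)) * (Im (z$j) + Im (u$j))\<bar>)" by (rule sum_abs)
  also have "\<dots> \<le> real CARD('n) * (4 * (\<epsilon> * R))"
  proof (rule bnd)
    fix j assume "j \<noteq> e"
    note zu = zu[OF this]
    have "\<bar>Re (z$j) - Re (u$j)\<bar> * \<bar>Im (z$j) + Im (u$j)\<bar> \<le> (2 * ?A) * (2 * ?A)"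
      using zu by (intro mult_mono) auto
    also have "\<dots> = 4 * (?A * ?A)" by simp
    also have "\<dots> \<le> 4 * (\<epsilon> * R)" unfolding A2 using ee by simp
    finally show "\<bar>(Re (z$j) - Re (u$j)) * (Im (z$j) + Im (u$j))\<bar> \<le> 4 * (\<epsilon> * R)" by (simp add: abs_mult)
  qed (use eps R in auto)
  finally have T: "\<bar>?\<Theta>\<bar> \<le> real CARD('n) * (4 * (\<epsilon> * R))" .
  have ze: "\<bar>Re (z$e)\<bar> \<le> \<epsilon> * R" "\<bar>Re (u$e)\<bar> \<le> \<epsilon> * R" "l1 \<le> tb_rho e z" "tb_rho e z \<le> h1" "l2 \<le> tb_rho e u" "tb_rho e u \<le> h2"
    using z u by (auto simp: tset_def)
  have hR: "h1 + h2 \<le> R + 2 * (\<epsilon> * R)" using h by (simp add: algebra_simps)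
  have Re1: "\<bar>Re (tb_rho2 e z u) - R / 2\<bar> \<le> (2 * real CARD('n) + 1) * (\<epsilon> * R)"
    using Re_tb_rho2[of e z u] S0 S1 ze l hR by (simp add: algebra_simps abs_le_iff)
  have Im1: "\<bar>Im (tb_rho2 e z u)\<bar> \<le> (2 * real CARD('n) + 1) * (\<epsilon> * R)"
    using Im_tb_rho2[of e z u] T ze by (simp add: algebra_simps abs_le_iff)
  have "cmod (tb_rho2 e z u - of_real R / 2) \<le> \<bar>Re (tb_rho2 e z u - of_real R / 2)\<bar> + \<bar>Im (tb_rho2 e z u - of_real R / 2)\<bar>"
    by (rule cmod_le)
  also have "\<dots> \<le> 2 * ((2 * real CARD('n) + 1) * (\<epsilon> * R))" using Re1 Im1 by simp
  finally have "cmod (tb_rho2 e z u - of_real R / 2) \<le> 2 * ((2 * real CARD('n) + 1) * (\<epsilon> * R))" .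
  moreover have "tb_rho2 e z u / of_real R - 1 / 2 = (tb_rho2 e z u - of_real R / 2) / of_real R"
    using R by (simp add: field_simps)
  ultimately show ?thesis using R by (simp add: norm_divide divide_le_eq algebra_simps)
qed

text \<open>At x = 1/2 the function 1 / x^c is continuous with the positive value 2^c, so its real
  part is at least half of this nearby. The principal power is multiplicative for positive real
  factors, which reduces scale R to scale 1 and makes \<epsilon> and \<kappa> independent of
  R.\<close>

lemma Re_inverse_tb_rho2_powr_ge:
  fixes e :: "'n::finite" and c :: real
  obtains \<epsilon> \<kappa> where "0 < \<epsilon>" "\<epsilon> < 1" "0 < \<kappa>"
    "\<And>R z u l1 h1 l2 h2. 0 < R \<Longrightarrow> z \<in> tset e (\<epsilon> * sqrt R) (\<epsilon> * R) l1 h1 \<Longrightarrow> u \<in> tset e (\<epsilon> * sqrt R) (\<epsilon> * R) l2 h2 \<Longrightarrow>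
      l1 + l2 \<ge> R \<Longrightarrow> h1 + h2 \<le> (1 + 2 * \<epsilon>) * R \<Longrightarrow> \<kappa> * R powr (-c) \<le> Re (1 / (tb_rho2 e z u powr of_real c))"
proof -
  define \<kappa> where "\<kappa> = (1 / 2) powr (-c) / 2"
  have \<kappa>: "0 < \<kappa>" by (simp add: \<kappa>_def)
  have half: "1 / ((1 / 2 :: complex) powr of_real c) = of_real (2 * \<kappa>)"
  proof -
    have "(1 / 2 :: complex) powr of_real c = of_real ((1 / 2) powr c)"
      using powr_of_real[of "1/2" c] by simp
    then show ?thesis by (simp add: \<kappa>_def powr_minus_divide)
  qed
  have "((\<lambda>x. Re (1 / (x powr of_real c))) \<longlongrightarrow> Re (1 / ((1 / 2 :: complex) powr of_real c))) (at (1 / 2))"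
    by (intro tendsto_intros tendsto_powr_complex) (auto simp: complex_nonpos_Reals_iff)
  then have "((\<lambda>x. Re (1 / (x powr of_real c))) \<longlongrightarrow> 2 * \<kappa>) (at (1 / 2 :: complex))"
    by (simp only: half Re_complex_of_real)
  then have "\<exists>\<delta>>0. \<forall>x::complex. x \<noteq> 1 / 2 \<and> dist x (1 / 2) < \<delta> \<longrightarrow> dist (Re (1 / (x powr of_real c))) (2 * \<kappa>) < \<kappa>"
    using \<kappa> unfolding LIM_def by blast
  then obtain \<delta> where \<delta>: "0 < \<delta>"
    "\<And>x::complex. x \<noteq> 1 / 2 \<Longrightarrow> dist x (1 / 2) < \<delta> \<Longrightarrow> dist (Re (1 / (x powr of_real c))) (2 * \<kappa>) < \<kappa>"
    by blast
  \<comment> \<open>The limit says nothing about the point 1/2 itself, which is treated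
    separately.\<close>
  have near: "\<kappa> \<le> Re (1 / (x powr of_real c))" if "cmod (x - 1 / 2) < \<delta>" for x :: complex
  proof (cases "x = 1 / 2")
    case True
    then show ?thesis using \<kappa> by (simp only: True half Re_complex_of_real)
  next
    case False
    from \<delta>(2)[OF this] that show ?thesis unfolding dist_norm real_norm_def by linarith
  qed
  \<comment> \<open>Half of what \<open>tb_rho2_near_half\<close> would allow, so that the distance
    to 1/2 is strictly below \<delta>.\<close>
  define \<epsilon> where "\<epsilon> = min (1 / 2) (\<delta> / (4 * (2 * real CARD('n) + 1)))"
  have \<epsilon>: "0 < \<epsilon>" "\<epsilon> < 1" using \<delta>(1) by (auto simp: \<epsilon>_def)
  have "\<epsilon> \<le> \<delta> / (4 * (2 * real CARD('n) + 1))" by (simp add: \<epsilon>_def)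
  then have "4 * (2 * real CARD('n) + 1) * \<epsilon> \<le> \<delta>" by (simp add: field_simps)
  then have \<epsilon>\<delta>: "2 * (2 * real CARD('n) + 1) * \<epsilon> < \<delta>" using \<delta>(1) by (simp add: algebra_simps)
  show thesis
  proof (rule that[OF \<epsilon> \<kappa>])
    fix R :: real and z u :: "complex^'n" and l1 h1 l2 h2
    assume *: "0 < R" "z \<in> tset e (\<epsilon> * sqrt R) (\<epsilon> * R) l1 h1" "u \<in> tset e (\<epsilon> * sqrt R) (\<epsilon> * R) l2 h2"
      "l1 + l2 \<ge> R" "h1 + h2 \<le> (1 + 2 * \<epsilon>) * R"
    define x where "x = tb_rho2 e z u / of_real R"
    have "cmod (x - 1 / 2) < \<delta>"
      using tb_rho2_near_half[OF \<epsilon>(1) _ *] \<epsilon> \<epsilon>\<delta> by (simp add: x_def)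
    then have "\<kappa> \<le> Re (1 / (x powr of_real c))" by (rule near)
    then have le: "\<kappa> * R powr (-c) \<le> Re (1 / (x powr of_real c)) * R powr (-c)"
      by (intro mult_right_mono) auto
    have "tb_rho2 e z u = of_real R * x" using *(1) by (simp add: x_def)
    then have "1 / (tb_rho2 e z u powr of_real c) = (1 / (x powr of_real c)) * of_real (R powr (-c))"
      using *(1) by (simp add: powr_times_real_left powr_of_real powr_minus_divide)
    then have "Re (1 / (tb_rho2 e z u powr of_real c)) = Re (1 / (x powr of_real c)) * R powr (-c)"
      by (simp only: times_complex.sel Re_complex_of_real Im_complex_of_real mult_zero_right diff_zero)
    with le show "\<kappa> * R powr (-c) \<le> Re (1 / (tb_rho2 e z u powr of_real c))"
      by (simp only:)
  qed
qed

section \<open>Lower bounds for the complex kernel\<close>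

lemma (in pair_sigma_finite) integral_product_mult:
  fixes f :: "'a \<Rightarrow> 'c::{real_normed_field, banach, second_countable_topology}"
  assumes f: "integrable M1 f" and g: "integrable M2 g"
  shows "integral\<^sup>L (M1 \<Otimes>\<^sub>M M2) (\<lambda>y. f (fst y) * g (snd y)) = integral\<^sup>L M1 f * integral\<^sup>L M2 g"
proof -
  have [measurable]: "f \<in> borel_measurable M1" "g \<in> borel_measurable M2"
    using f g by (auto dest: borel_measurable_integrable)
  have "integrable (M1 \<Otimes>\<^sub>M M2) (\<lambda>y. f (fst y) * g (snd y))"
    using f g by (intro Fubini_integrable) (auto simp: norm_mult)
  from integral_fst'[OF this] show ?thesis using f g by simp
qed

definition kernT1 :: "'n::finite \<Rightarrow> real \<Rightarrow> real \<Rightarrow> real \<Rightarrow> complex^'n \<Rightarrow> complex^'n \<Rightarrow> complex" where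
  "kernT1 e a b c z u = of_real (tb_rho e z powr a * tb_rho e u powr b) / tb_rho2 e z u powr of_real c"

lemma kernT_eq_mult:
  "kernT e a b c x y = kernT1 e (fst a) (fst b) (fst c) (fst x) (fst y) * kernT1 e (snd a) (snd b) (snd c) (snd x) (snd y)"
  by (cases x; cases y) (simp add: kernT_def kernT1_def)

text \<open>Re rho(z,u) > 0 keeps the base of the complex power off the branch cut.\<close>

lemma continuous_on_kernT1:
  assumes "z \<in> TB e" "S \<subseteq> TB e"
  shows "continuous_on S (kernT1 e a b c z)"
proof -
  have pos: "0 < Re (tb_rho2 e z u)" "0 < tb_rho e u" if "u \<in> S" for u
    using assms that Re_tb_rho2_pos[of z e u] by (auto simp: TB_def)
  have nz: "tb_rho2 e z u \<noteq> 0" "tb_rho e u \<noteq> 0" if "u \<in> S" for u using pos[OF that] by auto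
  show ?thesis
    unfolding kernT1_def using pos nz
    by (intro continuous_intros) (auto intro: less_imp_le)
qed

lemma integrable_kernT1:
  assumes "z \<in> TB e" "compact S" "S \<subseteq> TB e" "continuous_on S g"
  shows "integrable lborel (\<lambda>u. indicator S u *\<^sub>R (kernT1 e a b c z u * complex_of_real (g u)))"
  using assms by (intro borel_integrable_compact continuous_intros continuous_on_kernT1) auto

text \<open>Only the lower bound on \<open>Z\<close> enters the norm of the image, which avoids the measurability of the
  complex power in both variables.\<close>
definition test :: "'n::finite \<Rightarrow> real \<Rightarrow> real \<Rightarrow> real \<Rightarrow> (complex^'n) set \<Rightarrow> (complex^'n \<Rightarrow> real) \<Rightarrow> (complex^'n) set \<Rightarrow> real \<Rightarrow> bool" where
  "test e a b c S g Z \<kappa> \<longleftrightarrow> compact S \<and> S \<subseteq> TB e \<and> continuous_on S g \<and> (\<forall>u\<in>S. 0 \<le> g u) \<and>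
     Z \<in> sets borel \<and> Z \<subseteq> TB e \<and> 0 \<le> \<kappa> \<and>
     (\<forall>z\<in>Z. \<kappa> * tb_rho e z powr a \<le> cmod (LINT u|lborel. indicator S u *\<^sub>R (kernT1 e a b c z u * complex_of_real (g u))))"

text \<open>The mixed norm of a product function is the product of the two norms, and so is the
  mixed norm of the lower bound for its image. The resulting product inequality allows one factor to
  be frozen later while the other varies.\<close>

lemma bounded_kop_test:
  fixes e :: "'n::finite"
  assumes bd: "bounded_kop e (kernT e a b c) p al q be"
    and p: "0 < fst p" "0 < snd p" and q: "0 < fst q" "0 < snd q"
  obtains C where "0 \<le> C" "\<And>S1 g1 Z1 \<kappa>1 S2 g2 Z2 \<kappa>2.
     test e (fst a) (fst b) (fst c) S1 g1 Z1 \<kappa>1 \<Longrightarrow> test e (snd a) (snd b) (snd c) S2 g2 Z2 \<kappa>2 \<Longrightarrow>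
     wnorm e (fst p) (fst al) (\<lambda>u. indicator S1 u * ennreal (g1 u)) < top \<Longrightarrow>
     wnorm e (snd p) (snd al) (\<lambda>u. indicator S2 u * ennreal (g2 u)) < top \<Longrightarrow>
     wnorm e (fst q) (fst be) (\<lambda>z. indicator Z1 z * ennreal (\<kappa>1 * tb_rho e z powr fst a)) *
     wnorm e (snd q) (snd be) (\<lambda>z. indicator Z2 z * ennreal (\<kappa>2 * tb_rho e z powr snd a))
     \<le> ennreal C * (wnorm e (fst p) (fst al) (\<lambda>u. indicator S1 u * ennreal (g1 u)) *
       wnorm e (snd p) (snd al) (\<lambda>u. indicator S2 u * ennreal (g2 u)))"
proof -
  obtain C0 :: real where C0: "\<And>f. f \<in> borel_measurable (lborel \<Otimes>\<^sub>M lborel) \<Longrightarrow> mixnorm e p al f < \<infinity> \<Longrightarrow>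
      mixnorm e q be (kop e (kernT e a b c) f) \<le> ennreal C0 * mixnorm e p al f"
    using bd unfolding bounded_kop_def by blast
  \<comment> \<open>\<open>ennreal\<close> sends negative reals to 0, so the constant may be taken
    nonnegative.\<close>
  have C: "ennreal (max 0 C0) = ennreal C0" by (simp add: ennreal_eq_0_iff max_def ennreal_neg)
  show thesis
  proof (rule that[of "max 0 C0"])
    fix S1 g1 Z1 \<kappa>1 S2 g2 Z2 \<kappa>2
    assume t1: "test e (fst a) (fst b) (fst c) S1 g1 Z1 \<kappa>1" and t2: "test e (snd a) (snd b) (snd c) S2 g2 Z2 \<kappa>2"
    let ?\<phi>1 = "\<lambda>u. indicator S1 u * ennreal (g1 u)" and ?\<phi>2 = "\<lambda>u. indicator S2 u * ennreal (g2 u)"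
    let ?L1 = "\<lambda>z. indicator Z1 z * ennreal (\<kappa>1 * tb_rho e z powr fst a)"
    let ?L2 = "\<lambda>z. indicator Z2 z * ennreal (\<kappa>2 * tb_rho e z powr snd a)"
    assume fin: "wnorm e (fst p) (fst al) ?\<phi>1 < top" "wnorm e (snd p) (snd al) ?\<phi>2 < top"
    note t1 = t1[unfolded test_def] and t2 = t2[unfolded test_def]
    have [measurable]: "Z1 \<in> sets borel" "Z2 \<in> sets borel" using t1 t2 by auto
    have m: "(\<lambda>u. indicator S1 u *\<^sub>R g1 u) \<in> borel_measurable borel" "(\<lambda>u. indicator S2 u *\<^sub>R g2 u) \<in> borel_measurable borel"
      using borel_integrable_compact[of S1 g1] borel_integrable_compact[of S2 g2] t1 t2
      by (auto dest!: borel_measurable_integrable)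
    define f where "f y = complex_of_real ((indicator S1 (fst y) *\<^sub>R g1 (fst y)) * (indicator S2 (snd y) *\<^sub>R g2 (snd y)))" for y
    have f [measurable]: "f \<in> borel_measurable (lborel \<Otimes>\<^sub>M lborel)"
      unfolding f_def using m by measurable
    have e1: "ennreal (indicator S1 u *\<^sub>R g1 u) = ?\<phi>1 u" "ennreal (indicator S2 u *\<^sub>R g2 u) = ?\<phi>2 u" for u
      by (auto split: split_indicator)
    have [measurable]: "?\<phi>1 \<in> borel_measurable borel" "?\<phi>2 \<in> borel_measurable borel"
      using m unfolding e1[symmetric] by measurable
    have cf: "ennreal (cmod (f (z, w))) = ?\<phi>2 w * ?\<phi>1 z" for z w
      using t1 t2 by (auto simp: f_def norm_mult ennreal_mult mult.commute split: split_indicator)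
    have mf: "mixnorm e p al f = wnorm e (fst p) (fst al) ?\<phi>1 * wnorm e (snd p) (snd al) ?\<phi>2"
      using p by (simp add: mixnorm_eq_wnorm cf wnorm_cmult mult.commute[of _ "wnorm e (fst p) (fst al) ?\<phi>1"])
    have low: "?L2 w * ?L1 z \<le> ennreal (cmod (kop e (kernT e a b c) f (z, w)))" if zw: "z \<in> TB e" "w \<in> TB e" for z w
    proof -
      let ?I1 = "\<lambda>u. indicator S1 u *\<^sub>R (kernT1 e (fst a) (fst b) (fst c) z u * complex_of_real (g1 u))"
      let ?I2 = "\<lambda>u. indicator S2 u *\<^sub>R (kernT1 e (snd a) (snd b) (snd c) w u * complex_of_real (g2 u))"
      have "kop e (kernT e a b c) f (z, w) = integral\<^sup>L (lborel \<Otimes>\<^sub>M lborel) (\<lambda>y. ?I1 (fst y) * ?I2 (snd y))"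
        unfolding kop_def set_lebesgue_integral_def using t1 t2
        by (intro Bochner_Integration.integral_cong refl)
           (auto simp: kernT_eq_mult f_def split: split_indicator)
      also have "\<dots> = integral\<^sup>L lborel ?I1 * integral\<^sup>L lborel ?I2"
        using t1 t2 zw by (intro lborel_pair.integral_product_mult integrable_kernT1) auto
      finally have k: "kop e (kernT e a b c) f (z, w) = integral\<^sup>L lborel ?I1 * integral\<^sup>L lborel ?I2" .
      have "?L1 z \<le> ennreal (cmod (integral\<^sup>L lborel ?I1))" "?L2 w \<le> ennreal (cmod (integral\<^sup>L lborel ?I2))"
        using t1 t2 by (auto split: split_indicator intro!: ennreal_leI)
      then have "?L2 w * ?L1 z \<le> ennreal (cmod (integral\<^sup>L lborel ?I2)) * ennreal (cmod (integral\<^sup>L lborel ?I1))"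
        by (intro mult_mono zero_le)
      also have "\<dots> = ennreal (cmod (kop e (kernT e a b c) f (z, w)))"
        unfolding k norm_mult by (subst ennreal_mult[symmetric]) (auto simp: mult.commute)
      finally show ?thesis .
    qed
    have "wnorm e (fst q) (fst be) ?L1 * wnorm e (snd q) (snd be) ?L2
       = wnorm e (snd q) (snd be) (\<lambda>w. wnorm e (fst q) (fst be) (\<lambda>z. ?L2 w * ?L1 z))"
      using q by (simp add: wnorm_cmult mult.commute[of _ "wnorm e (fst q) (fst be) ?L1"])
    also have "\<dots> \<le> mixnorm e q be (kop e (kernT e a b c) f)"
      unfolding mixnorm_eq_wnorm[OF q] using q by (intro wnorm_mono low) auto
    also have "\<dots> \<le> ennreal C0 * mixnorm e p al f"
      using fin by (intro C0 f) (simp add: mf ennreal_mult_less_top)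
    finally show "wnorm e (fst q) (fst be) ?L1 * wnorm e (snd q) (snd be) ?L2
       \<le> ennreal (max 0 C0) * (wnorm e (fst p) (fst al) ?\<phi>1 * wnorm e (snd p) (snd al) ?\<phi>2)"
      unfolding C mf .
  qed simp
qed

text \<open>Nothing cancels on these sets: the real part of the kernel is at least \<kappa> rho(z)^a
  rho(u)^b, so the modulus of the integral is at least \<kappa> rho(z)^a times the integral of
  rho^(b+s) over the set of u.\<close>

lemma test_tset:
  fixes e :: "'n::finite" and \<epsilon> R :: real
  assumes eps: "0 < \<epsilon>" and R: "0 < R" and \<kappa>: "0 \<le> \<kappa>"
    and low: "\<And>z u. z \<in> tset e (\<epsilon> * sqrt R) (\<epsilon> * R) l1 h1 \<Longrightarrow> u \<in> tset e (\<epsilon> * sqrt R) (\<epsilon> * R) l2 h2 \<Longrightarrow>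
      \<kappa> \<le> Re (1 / (tb_rho2 e z u powr of_real c))"
    and l: "0 < l1" "0 < l2"
  shows "test e a b c (tset e (\<epsilon> * sqrt R) (\<epsilon> * R) l2 h2) (\<lambda>u. tb_rho e u powr s) (tset e (\<epsilon> * sqrt R) (\<epsilon> * R) l1 h1)
    (\<kappa> * ((2 * \<epsilon>) ^ (2 * CARD('n) - 1) * R powr real CARD('n) * pint (b + s) l2 h2))"
proof -
  let ?S = "tset e (\<epsilon> * sqrt R) (\<epsilon> * R) l2 h2" and ?Z = "tset e (\<epsilon> * sqrt R) (\<epsilon> * R) l1 h1"
  let ?K = "(2 * \<epsilon>) ^ (2 * CARD('n) - 1) * R powr real CARD('n)"
  have S: "compact ?S" "?S \<subseteq> TB e" using assms by (auto intro!: compact_tset dest: tset_subset_TB)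
  have Z: "?Z \<subseteq> TB e" using l by (rule_tac tset_subset_TB)
  have pos: "0 < tb_rho e u" if "u \<in> ?S" for u using S that by (auto simp: TB_def)
  then have cont: "continuous_on ?S (\<lambda>u. tb_rho e u powr r)" for r
    by (intro continuous_intros) (auto simp: less_imp_neq[symmetric])
  have J: "(LINT u|lborel. indicator ?S u *\<^sub>R tb_rho e u powr (b + s)) = ?K * pint (b + s) l2 h2"
  proof -
    have "(\<integral>\<^sup>+u. ennreal (indicator ?S u *\<^sub>R tb_rho e u powr (b + s)) \<partial>lborel)
       = (\<integral>\<^sup>+u. indicator ?S u * ennreal (tb_rho e u powr (b + s)) \<partial>lborel)"
      by (intro nn_integral_cong) (auto split: split_indicator)
    also have "\<dots> = ennreal ?K * (\<integral>\<^sup>+t. indicator {l2..h2} t * ennreal (t powr (b + s)) \<partial>lborel)"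
      using eps R by (intro nn_integral_tset) auto
    also have "\<dots> = ennreal (?K * pint (b + s) l2 h2)"
      using l eps pint_nonneg by (simp add: nn_integral_pint ennreal_mult)
    finally show ?thesis
      using eps pint_nonneg by (subst integral_eq_nn_integral) (auto split: split_indicator)
  qed
  have "\<kappa> * (?K * pint (b + s) l2 h2) * tb_rho e z powr a
      \<le> cmod (LINT u|lborel. indicator ?S u *\<^sub>R (kernT1 e a b c z u * complex_of_real (tb_rho e u powr s)))" if z: "z \<in> ?Z" for z
  proof -
    have zT: "z \<in> TB e" using z Z by auto
    have int: "integrable lborel (\<lambda>u. indicator ?S u *\<^sub>R (kernT1 e a b c z u * complex_of_real (tb_rho e u powr s)))"
      using S cont zT by (intro integrable_kernT1) auto
    have "\<kappa> * (?K * pint (b + s) l2 h2) * tb_rho e z powr a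
        = (LINT u|lborel. (\<kappa> * tb_rho e z powr a) * (indicator ?S u *\<^sub>R tb_rho e u powr (b + s)))"
      unfolding integral_mult_right_zero J by (simp only: mult_ac)
    also have "\<dots> \<le> (LINT u|lborel. Re (indicator ?S u *\<^sub>R (kernT1 e a b c z u * complex_of_real (tb_rho e u powr s))))"
    proof (rule integral_mono)
      show "integrable lborel (\<lambda>u. (\<kappa> * tb_rho e z powr a) * (indicator ?S u *\<^sub>R tb_rho e u powr (b + s)))"
        using borel_integrable_compact[OF S(1) cont] by (rule integrable_mult_right)
      show "integrable lborel (\<lambda>u. Re (indicator ?S u *\<^sub>R (kernT1 e a b c z u * complex_of_real (tb_rho e u powr s))))"
        using int by (rule integrable_Re)
      fix u
      show "(\<kappa> * tb_rho e z powr a) * (indicator ?S u *\<^sub>R tb_rho e u powr (b + s))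
         \<le> Re (indicator ?S u *\<^sub>R (kernT1 e a b c z u * complex_of_real (tb_rho e u powr s)))"
      proof (cases "u \<in> ?S")
        case True
        have "kernT1 e a b c z u * complex_of_real (tb_rho e u powr s)
            = of_real (tb_rho e z powr a * tb_rho e u powr (b + s)) * (1 / (tb_rho2 e z u powr of_real c))"
          by (simp add: kernT1_def powr_add)
        then have "Re (kernT1 e a b c z u * complex_of_real (tb_rho e u powr s))
            = (tb_rho e z powr a * tb_rho e u powr (b + s)) * Re (1 / (tb_rho2 e z u powr of_real c))"
          by (metis Re_complex_of_real Im_complex_of_real times_complex.sel(1) mult_zero_left diff_zero)
        moreover have "(tb_rho e z powr a * tb_rho e u powr (b + s)) * \<kappa>
            \<le> (tb_rho e z powr a * tb_rho e u powr (b + s)) * Re (1 / (tb_rho2 e z u powr of_real c))"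
          using low[OF z True] by (intro mult_left_mono) auto
        ultimately show ?thesis using True by (simp add: mult_ac)
      qed simp
    qed
    also have "\<dots> = Re (LINT u|lborel. indicator ?S u *\<^sub>R (kernT1 e a b c z u * complex_of_real (tb_rho e u powr s)))"
      using int by (rule integral_Re)
    also have "\<dots> \<le> cmod (LINT u|lborel. indicator ?S u *\<^sub>R (kernT1 e a b c z u * complex_of_real (tb_rho e u powr s)))"
      by (rule complex_Re_le_cmod)
    finally show ?thesis .
  qed
  then show ?thesis
    unfolding test_def using S Z cont \<kappa> eps pint_nonneg by auto
qed

text \<open>Serves both sides of a test: with coefficient 1 and the power s for the test function,
  and with the power a for the lower bound of its image.\<close>

lemma wnorm_tset:
  fixes e :: "'n::finite" and \<epsilon> R :: real
  assumes eps: "0 < \<epsilon>" and R: "0 < R" and l: "0 < l" and p: "0 < p" and \<kappa>: "0 \<le> \<kappa>"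
  shows "wnorm e p al (\<lambda>u. indicator (tset e (\<epsilon> * sqrt R) (\<epsilon> * R) l h) u * ennreal (\<kappa> * tb_rho e u powr s))
    = ennreal (\<kappa> * ((2 * \<epsilon>) ^ (2 * CARD('n) - 1) * R powr real CARD('n) * pint (s * p + al) l h) powr (1 / p))"
proof -
  let ?S = "tset e (\<epsilon> * sqrt R) (\<epsilon> * R) l h"
  let ?K = "(2 * \<epsilon>) ^ (2 * CARD('n) - 1) * R powr real CARD('n)"
  have "(\<integral>\<^sup>+u. indicator (TB e) u * ennpow (indicator ?S u * ennreal (\<kappa> * tb_rho e u powr s)) p * ennreal (tb_rho e u powr al) \<partial>lborel)
     = (\<integral>\<^sup>+u. ennreal (\<kappa> powr p) * (indicator ?S u * ennreal (tb_rho e u powr (s * p + al))) \<partial>lborel)"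
  proof (rule nn_integral_cong)
    fix u
    show "indicator (TB e) u * ennpow (indicator ?S u * ennreal (\<kappa> * tb_rho e u powr s)) p * ennreal (tb_rho e u powr al)
      = ennreal (\<kappa> powr p) * (indicator ?S u * ennreal (tb_rho e u powr (s * p + al)))"
    proof (cases "u \<in> ?S")
      case True
      then have "u \<in> TB e" using tset_subset_TB[OF l] by blast
      then show ?thesis using True \<kappa>
        by (simp add: ennpow_ennreal powr_mult powr_powr powr_add ennreal_mult[symmetric] mult_ac)
    qed simp
  qed
  also have "\<dots> = ennreal (\<kappa> powr p) * (ennreal ?K * ennreal (pint (s * p + al) l h))"
    using nn_integral_tset[of "\<lambda>t. ennreal (t powr (s * p + al))" \<epsilon> R e l h] eps R
    by (simp only: nn_integral_pint[OF l]) (simp add: nn_integral_cmult)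
  also have "\<dots> = ennreal (\<kappa> powr p * (?K * pint (s * p + al) l h))"
    using eps pint_nonneg by (simp add: ennreal_mult)
  finally show ?thesis
    unfolding wnorm_def using \<kappa> p eps pint_nonneg[of "s * p + al" l h] 
    by (simp add: ennpow_ennreal powr_mult powr_powr)
qed

section \<open>Necessity and the equivalence\<close>

text \<open>Applied to the scale R, where it yields the formula for c, and to the size x of a
  logarithm, where it would force p = 1.\<close>

lemma powr_bounded_imp_exponent_0:
  fixes E M :: real
  assumes "\<And>R. 0 < R \<Longrightarrow> R powr E \<le> M"
  shows "E = 0"
proof (rule ccontr)
  assume "E \<noteq> 0"
  then have "((\<bar>M\<bar> + 1) powr (1 / E)) powr E = \<bar>M\<bar> + 1" by (simp add: powr_powr)
  moreover have "((\<bar>M\<bar> + 1) powr (1 / E)) powr E \<le> M" by (rule assms) auto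
  ultimately show False by linarith
qed

lemma kernT1_necessary:
  fixes e :: "'n::finite"
  defines "n \<equiv> real CARD('n)"
  assumes p: "1 < p" and q: "0 < q" and C: "0 \<le> C"
    and bd: "\<And>S g Z \<kappa>. test e a b c S g Z \<kappa> \<Longrightarrow> wnorm e p al (\<lambda>u. indicator S u * ennreal (g u)) < top \<Longrightarrow>
      wnorm e q be (\<lambda>z. indicator Z z * ennreal (\<kappa> * tb_rho e z powr a))
        \<le> ennreal C * wnorm e p al (\<lambda>u. indicator S u * ennreal (g u))"
  shows "- q * a < be + 1" "al + 1 < p * (b + 1)"
    "c = n + 1 + a + b + ((n + 1 + be) / q - (n + 1 + al) / p)"
proof -
  obtain \<epsilon> \<kappa> where \<epsilon>: "0 < \<epsilon>" "\<epsilon> < 1" and \<kappa>: "0 < \<kappa>" and low: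
    "\<And>R z u l1 h1 l2 h2. 0 < R \<Longrightarrow> z \<in> tset e (\<epsilon> * sqrt R) (\<epsilon> * R) l1 h1 \<Longrightarrow> u \<in> tset e (\<epsilon> * sqrt R) (\<epsilon> * R) l2 h2 \<Longrightarrow>
      l1 + l2 \<ge> R \<Longrightarrow> h1 + h2 \<le> (1 + 2 * \<epsilon>) * R \<Longrightarrow> \<kappa> * R powr (-c) \<le> Re (1 / (tb_rho2 e z u powr of_real c))"
    using Re_inverse_tb_rho2_powr_ge[of e c] by blast
  define K where "K = (2 * \<epsilon>) ^ (2 * CARD('n) - 1)"
  have K: "0 < K" using \<epsilon> by (simp add: K_def)
  have p0: "0 < p" using p by simp
  \<comment> \<open>The test inequality for arbitrary heights of the two sets and an arbitrary power
    s of rho as test function. All three conclusions are choices of these parameters.\<close>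
  have key: "\<kappa> * R powr (-c) * (K * R powr n * pint (b + s) l2 h2) * (K * R powr n * pint (a * q + be) l1 h1) powr (1 / q)
     \<le> C * (K * R powr n * pint (s * p + al) l2 h2) powr (1 / p)"
    if R: "0 < R" and l: "0 < l1" "0 < l2" "l1 + l2 \<ge> R" and h: "h1 + h2 \<le> (1 + 2 * \<epsilon>) * R" for R l1 h1 l2 h2 s
  proof -
    let ?S = "tset e (\<epsilon> * sqrt R) (\<epsilon> * R) l2 h2" and ?Z = "tset e (\<epsilon> * sqrt R) (\<epsilon> * R) l1 h1"
    let ?k = "\<kappa> * R powr (-c) * (K * R powr n * pint (b + s) l2 h2)"
    have k0: "0 \<le> ?k" using \<kappa> K pint_nonneg by simp
    have t: "test e a b c ?S (\<lambda>u. tb_rho e u powr s) ?Z ?k"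
      unfolding K_def n_def using \<epsilon> R \<kappa> l h by (intro test_tset low) auto
    have w1: "wnorm e p al (\<lambda>u. indicator ?S u * ennreal (tb_rho e u powr s))
        = ennreal ((K * R powr n * pint (s * p + al) l2 h2) powr (1 / p))"
      using wnorm_tset[OF \<epsilon>(1) R l(2) p0, of 1 e al h2 s] by (simp add: K_def n_def)
    have w2: "wnorm e q be (\<lambda>z. indicator ?Z z * ennreal (?k * tb_rho e z powr a))
        = ennreal (?k * (K * R powr n * pint (a * q + be) l1 h1) powr (1 / q))"
      unfolding K_def n_def by (rule wnorm_tset[OF \<epsilon>(1) R l(1) q k0[unfolded K_def n_def]])
    from bd[OF t] have "ennreal (?k * (K * R powr n * pint (a * q + be) l1 h1) powr (1 / q))
        \<le> ennreal C * ennreal ((K * R powr n * pint (s * p + al) l2 h2) powr (1 / p))"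
      unfolding w1 w2 by simp
    also have "\<dots> = ennreal (C * (K * R powr n * pint (s * p + al) l2 h2) powr (1 / p))"
      using C by (simp add: ennreal_mult)
    finally show ?thesis using C by (subst (asm) ennreal_le_iff) auto
  qed
  define A where "A = pint al 1 (1 + \<epsilon>)"
  define B where "B = pint b 1 (1 + \<epsilon>)"
  define P where "P t = pint (a * q + be) t \<epsilon>" for t
  have AB: "0 < A" "0 < B" using \<epsilon> by (auto simp: A_def B_def intro!: pint_pos)
  \<comment> \<open>The total power of R when all heights are proportional to R; E = 0 is the
    formula for c.\<close>
  define E where "E = n + 1 + b - c + (n + 1 + a * q + be) / q - (n + 1 + al) / p"
  define D1 where "D1 = \<kappa> * K * B * K powr (1 / q)"
  define D2 where "D2 = C * (K * A) powr (1 / p)"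
  have D1: "0 < D1" using \<kappa> K AB by (simp add: D1_def)
  \<comment> \<open>Heights in [tR, \<epsilon>R] for z and in [R, (1 + \<epsilon>)R] for u, whose
    upper ends add up to exactly (1 + 2\<epsilon>)R. R and t are independent: R varies for the
    formula for c, t for the condition on a.\<close>
  have key1: "D1 * P t powr (1 / q) * R powr E \<le> D2" if R: "0 < R" and t: "0 < t" for R t
  proof -
    have s1: "pint b R ((1 + \<epsilon>) * R) = R powr (b + 1) * B" "pint al R ((1 + \<epsilon>) * R) = R powr (al + 1) * A"
      using pint_scale[of 1 R _ "1 + \<epsilon>"] R by (auto simp: A_def B_def mult.commute)
    have s2: "pint (a * q + be) (t * R) (\<epsilon> * R) = R powr (a * q + be + 1) * P t"
      using pint_scale[of t R _ \<epsilon>] R t by (auto simp: P_def mult.commute)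
    have "\<kappa> * R powr (-c) * (K * R powr n * pint (b + 0) R ((1 + \<epsilon>) * R)) * (K * R powr n * pint (a * q + be) (t * R) (\<epsilon> * R)) powr (1 / q)
     \<le> C * (K * R powr n * pint (0 * p + al) R ((1 + \<epsilon>) * R)) powr (1 / p)"
      using R t by (intro key) (auto simp: algebra_simps)
    then have "\<kappa> * R powr (-c) * (K * R powr n * (R powr (b + 1) * B)) * (K * R powr n * (R powr (a * q + be + 1) * P t)) powr (1 / q)
     \<le> C * (K * R powr n * (R powr (al + 1) * A)) powr (1 / p)"
      by (simp add: s1 s2)
    moreover have "\<kappa> * R powr (-c) * (K * R powr n * (R powr (b + 1) * B)) * (K * R powr n * (R powr (a * q + be + 1) * P t)) powr (1 / q)
      = D1 * P t powr (1 / q) * R powr (n + 1 + b - c + (n + 1 + a * q + be) / q)"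
    proof -
      have e1: "K * R powr n * (R powr (a * q + be + 1) * P t) = K * P t * R powr (n + 1 + a * q + be)"
        by (simp add: powr_add mult_ac)
      have e2: "(K * R powr n * (R powr (a * q + be + 1) * P t)) powr (1 / q)
          = K powr (1 / q) * P t powr (1 / q) * R powr ((n + 1 + a * q + be) / q)"
        unfolding e1 using K R pint_nonneg by (simp add: P_def powr_mult powr_powr)
      have e3: "\<kappa> * R powr (-c) * (K * R powr n * (R powr (b + 1) * B)) = \<kappa> * K * B * R powr (n + 1 + b - c)"
        using R by (simp add: powr_add powr_diff powr_minus field_simps)
      show ?thesis
        unfolding e2 e3 D1_def powr_add[of R "n + 1 + b - c" "(n + 1 + a * q + be) / q"] by (simp only: mult_ac)
    qed
    moreover have "C * (K * R powr n * (R powr (al + 1) * A)) powr (1 / p) = D2 * R powr ((n + 1 + al) / p)"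
    proof -
      have e1: "K * R powr n * (R powr (al + 1) * A) = K * A * R powr (n + 1 + al)"
        by (simp add: powr_add mult_ac)
      show ?thesis unfolding e1 using K AB by (simp add: D2_def powr_mult powr_powr)
    qed
    ultimately have "D1 * P t powr (1 / q) * R powr (n + 1 + b - c + (n + 1 + a * q + be) / q) \<le> D2 * R powr ((n + 1 + al) / p)"
      by simp
    then have "D1 * P t powr (1 / q) * R powr (n + 1 + b - c + (n + 1 + a * q + be) / q) / R powr ((n + 1 + al) / p) \<le> D2"
      using R by (simp add: divide_le_eq)
    then show ?thesis by (simp add: E_def powr_diff)
  qed
  have "E = 0"
  proof (rule powr_bounded_imp_exponent_0)
    fix R :: real assume R: "0 < R"
    have "0 < P (\<epsilon> / 2)" unfolding P_def using \<epsilon> by (intro pint_pos) auto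
    then have "0 < D1 * P (\<epsilon> / 2) powr (1 / q)" using D1 by simp
    then show "R powr E \<le> D2 / (D1 * P (\<epsilon> / 2) powr (1 / q))"
      using key1[OF R, of "\<epsilon> / 2"] \<epsilon> by (simp add: le_divide_eq mult.commute)
  qed
  then show "c = n + 1 + a + b + ((n + 1 + be) / q - (n + 1 + al) / p)"
    using q by (simp add: E_def add_divide_distrib)
  have lnx: "ln (\<epsilon> / (\<epsilon> * exp (- x))) = x" "0 < \<epsilon> * exp (- x)" for x
    using \<epsilon> by (auto simp: exp_minus field_simps)
  have lne: "\<epsilon> * exp (- x) \<le> \<epsilon>" if "0 \<le> x" for x using \<epsilon> that by simp
  show "- q * a < be + 1"
  proof (rule ccontr)
    assume "\<not> ?thesis"
    then have le: "a * q + be \<le> -1" by (simp add: algebra_simps)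
    \<comment> \<open>By \<open>key1\<close> with R = 1, M bounds P(t) for all t > 0. If the
      exponent is at most -1, P(t) dominates ln(\<epsilon>/t), and t = \<epsilon> exp(-(M + 1))
      makes this logarithm M + 1.\<close>
    define M where "M = (D2 / D1) powr q"
    have M: "0 \<le> M" by (simp add: M_def)
    have "M + 1 = pint (-1) (\<epsilon> * exp (- (M + 1))) \<epsilon>"
      using pint_minus_one[OF lnx(2) lne, of "M + 1"] M unfolding lnx(1) by simp
    also have "\<dots> \<le> P (\<epsilon> * exp (- (M + 1)))"
      unfolding P_def using \<epsilon> le by (intro pint_mono lnx) auto
    also have "\<dots> = (P (\<epsilon> * exp (- (M + 1))) powr (1 / q)) powr q"
      using q pint_nonneg by (simp add: P_def powr_powr)
    also have "\<dots> \<le> (D2 / D1) powr q"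
    proof (rule powr_mono2)
      show "P (\<epsilon> * exp (- (M + 1))) powr (1 / q) \<le> D2 / D1"
        using key1[OF zero_less_one lnx(2)[of "M + 1"]] D1 by (simp add: le_divide_eq mult.commute)
    qed (use q in auto)
    also have "\<dots> = M" by (simp add: M_def)
    finally show False by simp
  qed
  show "al + 1 < p * (b + 1)"
  proof (rule ccontr)
    assume "\<not> ?thesis"
    then have ge: "-1 \<le> - (b + 1) * p + al" by (simp add: algebra_simps)
    define G where "G = (K * pint (a * q + be) 1 (1 + \<epsilon>)) powr (1 / q)"
    have G: "0 < G" unfolding G_def using K \<epsilon> pint_pos[of 1 "1 + \<epsilon>" "a * q + be"] by simp
    \<comment> \<open>Now R = 1, u has heights in [\<tau>, \<epsilon>] and z in [1, 1 + \<epsilon>].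
      The power s = -(b + 1) turns the kernel integral into x = K ln(\<epsilon>/\<tau>), while the
      p-th power of the norm of the test function is at most x. Every x > 0 is attained by a
      suitable \<tau>, and x cannot stay below a multiple of x^(1/p) when p > 1.\<close>
    have bound: "\<kappa> * G * x \<le> C * x powr (1 / p)" if x: "0 < x" for x
    proof -
      define \<tau> where "\<tau> = \<epsilon> * exp (- (x / K))"
      have \<tau>: "0 < \<tau>" "\<tau> \<le> \<epsilon>" using lnx(2) lne[of "x / K"] x K by (auto simp: \<tau>_def)
      have L: "K * pint (-1) \<tau> \<epsilon> = x"
        using K unfolding pint_minus_one[OF \<tau>] unfolding \<tau>_def lnx(1) by simp
      have "\<kappa> * 1 powr (-c) * (K * 1 powr n * pint (b + - (b + 1)) \<tau> \<epsilon>) * (K * 1 powr n * pint (a * q + be) 1 (1 + \<epsilon>)) powr (1 / q)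
        \<le> C * (K * 1 powr n * pint (- (b + 1) * p + al) \<tau> \<epsilon>) powr (1 / p)"
        using \<tau> by (intro key) auto
      then have "\<kappa> * (K * pint (-1) \<tau> \<epsilon>) * G \<le> C * (K * pint (- (b + 1) * p + al) \<tau> \<epsilon>) powr (1 / p)"
        by (simp add: G_def)
      also have "\<dots> \<le> C * (K * pint (-1) \<tau> \<epsilon>) powr (1 / p)"
        using C K p0 \<epsilon> \<tau> ge pint_nonneg by (intro mult_left_mono powr_mono2 pint_mono) auto
      finally show ?thesis by (simp add: L mult_ac)
    qed
    have "1 - 1 / p = 0"
    proof (rule powr_bounded_imp_exponent_0)
      fix x :: real assume x: "0 < x"
      have "x powr (1 - 1 / p) * (\<kappa> * G) = \<kappa> * G * x / x powr (1 / p)"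
        using x by (simp add: powr_diff)
      also have "\<dots> \<le> C" using bound[OF x] x by (simp add: divide_le_eq)
      finally show "x powr (1 - 1 / p) \<le> C / (\<kappa> * G)" using \<kappa> G by (simp add: le_divide_eq)
    qed
    then show False using p by simp
  qed
qed

text \<open>Supplies the test at which the other variable is frozen. Both sets keep a positive
  distance from the boundary, so the norms are finite and the lower bound is positive whatever the
  exponents are.\<close>

lemma exists_test:
  fixes e :: "'n::finite"
  assumes p: "0 < p" and q: "0 < q"
  obtains S g Z \<kappa> x y where "test e a b c S g Z \<kappa>"
    "wnorm e p al (\<lambda>u. indicator S u * ennreal (g u)) = ennreal x"
    "wnorm e q be (\<lambda>z. indicator Z z * ennreal (\<kappa> * tb_rho e z powr a)) = ennreal y" "0 \<le> x" "0 < y"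
proof -
  obtain \<epsilon> \<kappa> where \<epsilon>: "0 < \<epsilon>" "\<epsilon> < 1" and \<kappa>: "0 < \<kappa>" and low:
    "\<And>R z u l1 h1 l2 h2. 0 < R \<Longrightarrow> z \<in> tset e (\<epsilon> * sqrt R) (\<epsilon> * R) l1 h1 \<Longrightarrow> u \<in> tset e (\<epsilon> * sqrt R) (\<epsilon> * R) l2 h2 \<Longrightarrow>
      l1 + l2 \<ge> R \<Longrightarrow> h1 + h2 \<le> (1 + 2 * \<epsilon>) * R \<Longrightarrow> \<kappa> * R powr (-c) \<le> Re (1 / (tb_rho2 e z u powr of_real c))"
    using Re_inverse_tb_rho2_powr_ge[of e c] by blast
  have low1: "\<kappa> \<le> Re (1 / (tb_rho2 e z u powr of_real c))"
    if "z \<in> tset e (\<epsilon> * sqrt 1) (\<epsilon> * 1) (\<epsilon> / 2) \<epsilon>" "u \<in> tset e (\<epsilon> * sqrt 1) (\<epsilon> * 1) 1 (1 + \<epsilon>)" for z u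
    using low[OF zero_less_one that] \<epsilon> by simp
  let ?K = "(2 * \<epsilon>) ^ (2 * CARD('n) - 1) * 1 powr real CARD('n)"
  let ?k = "\<kappa> * (?K * pint (b + 0) 1 (1 + \<epsilon>))"
  let ?x = "1 * (?K * pint (0 * p + al) 1 (1 + \<epsilon>)) powr (1 / p)"
  let ?y = "?k * (?K * pint (a * q + be) (\<epsilon> / 2) \<epsilon>) powr (1 / q)"
  have k: "0 < ?k" using \<kappa> \<epsilon> pint_pos[of 1 "1 + \<epsilon>"] by simp
  have t: "test e a b c (tset e (\<epsilon> * sqrt 1) (\<epsilon> * 1) 1 (1 + \<epsilon>)) (\<lambda>u. tb_rho e u powr 0)
      (tset e (\<epsilon> * sqrt 1) (\<epsilon> * 1) (\<epsilon> / 2) \<epsilon>) ?k"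
    using \<epsilon> \<kappa> by (intro test_tset low1) auto
  have x: "wnorm e p al (\<lambda>u. indicator (tset e (\<epsilon> * sqrt 1) (\<epsilon> * 1) 1 (1 + \<epsilon>)) u * ennreal (tb_rho e u powr 0)) = ennreal ?x"
    using wnorm_tset[OF \<epsilon>(1) zero_less_one zero_less_one p zero_le_one, of e al "1 + \<epsilon>" 0] by simp
  have y: "wnorm e q be (\<lambda>z. indicator (tset e (\<epsilon> * sqrt 1) (\<epsilon> * 1) (\<epsilon> / 2) \<epsilon>) z * ennreal (?k * tb_rho e z powr a)) = ennreal ?y"
    using \<epsilon> k by (intro wnorm_tset q) auto
  have y0: "0 < ?y"
    using \<epsilon> pint_pos[of "\<epsilon> / 2" \<epsilon> "a * q + be"] by (intro mult_pos_pos[OF k]) simp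
  show thesis by (rule that[OF t x y _ y0]) simp
qed

lemma ennreal_le_of_mult_le:
  assumes "0 < y" "0 \<le> C" "0 \<le> x" "w * ennreal y \<le> ennreal C * (v * ennreal x)"
  shows "w \<le> ennreal (C * x / y) * v"
proof -
  have "w = w * ennreal y * ennreal (1 / y)"
    using assms(1) by (simp add: mult.assoc ennreal_mult[symmetric])
  also have "\<dots> \<le> ennreal C * (v * ennreal x) * ennreal (1 / y)"
    by (intro mult_right_mono assms) auto
  also have "\<dots> = (ennreal C * ennreal x * ennreal (1 / y)) * v" by (simp only: mult_ac)
  also have "ennreal C * ennreal x * ennreal (1 / y) = ennreal (C * x / y)"
    using assms by (simp add: ennreal_mult[symmetric])
  finally show ?thesis .
qed

text \<open>Freezing one variable at the test from \<open>exists_test\<close> and dividing by its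
  known norms turns the product inequality into the one-variable hypothesis of
  \<open>kernT1_necessary\<close> for the other.\<close>

lemma bounded_kernT_imp:
  fixes e :: "'n::finite"
  defines "n \<equiv> real CARD('n)"
  assumes bd: "bounded_kop e (kernT e a b c) p al q be"
    and p: "1 < fst p" "1 < snd p" and q: "0 < fst q" "0 < snd q"
  shows "(- fst q * fst a < fst be + 1 \<and> fst al + 1 < fst p * (fst b + 1)
             \<and> fst c = n + 1 + fst a + fst b + ((n + 1 + fst be) / fst q - (n + 1 + fst al) / fst p))
        \<and> (- snd q * snd a < snd be + 1 \<and> snd al + 1 < snd p * (snd b + 1)
             \<and> snd c = n + 1 + snd a + snd b + ((n + 1 + snd be) / snd q - (n + 1 + snd al) / snd p))"
proof -
  have p0: "0 < fst p" "0 < snd p" using p by auto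
  obtain C where C: "0 \<le> C" "\<And>S1 g1 Z1 \<kappa>1 S2 g2 Z2 \<kappa>2.
     test e (fst a) (fst b) (fst c) S1 g1 Z1 \<kappa>1 \<Longrightarrow> test e (snd a) (snd b) (snd c) S2 g2 Z2 \<kappa>2 \<Longrightarrow>
     wnorm e (fst p) (fst al) (\<lambda>u. indicator S1 u * ennreal (g1 u)) < top \<Longrightarrow>
     wnorm e (snd p) (snd al) (\<lambda>u. indicator S2 u * ennreal (g2 u)) < top \<Longrightarrow>
     wnorm e (fst q) (fst be) (\<lambda>z. indicator Z1 z * ennreal (\<kappa>1 * tb_rho e z powr fst a)) *
     wnorm e (snd q) (snd be) (\<lambda>z. indicator Z2 z * ennreal (\<kappa>2 * tb_rho e z powr snd a))
     \<le> ennreal C * (wnorm e (fst p) (fst al) (\<lambda>u. indicator S1 u * ennreal (g1 u)) *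
       wnorm e (snd p) (snd al) (\<lambda>u. indicator S2 u * ennreal (g2 u)))"
    by (rule bounded_kop_test[OF bd p0 q]) blast
  obtain S1 g1 Z1 \<kappa>1 x1 y1 where t1: "test e (fst a) (fst b) (fst c) S1 g1 Z1 \<kappa>1"
    "wnorm e (fst p) (fst al) (\<lambda>u. indicator S1 u * ennreal (g1 u)) = ennreal x1"
    "wnorm e (fst q) (fst be) (\<lambda>z. indicator Z1 z * ennreal (\<kappa>1 * tb_rho e z powr fst a)) = ennreal y1" "0 \<le> x1" "0 < y1"
    by (rule exists_test[OF p0(1) q(1)])
  obtain S2 g2 Z2 \<kappa>2 x2 y2 where t2: "test e (snd a) (snd b) (snd c) S2 g2 Z2 \<kappa>2"
    "wnorm e (snd p) (snd al) (\<lambda>u. indicator S2 u * ennreal (g2 u)) = ennreal x2"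
    "wnorm e (snd q) (snd be) (\<lambda>z. indicator Z2 z * ennreal (\<kappa>2 * tb_rho e z powr snd a)) = ennreal y2" "0 \<le> x2" "0 < y2"
    by (rule exists_test[OF p0(2) q(2)])
  have b1: "wnorm e (fst q) (fst be) (\<lambda>z. indicator Z z * ennreal (\<kappa> * tb_rho e z powr fst a))
      \<le> ennreal (C * x2 / y2) * wnorm e (fst p) (fst al) (\<lambda>u. indicator S u * ennreal (g u))"
    if "test e (fst a) (fst b) (fst c) S g Z \<kappa>" "wnorm e (fst p) (fst al) (\<lambda>u. indicator S u * ennreal (g u)) < top" for S g Z \<kappa>
    using C(2)[OF that(1) t2(1) that(2)] unfolding t2(2,3)
    by (intro ennreal_le_of_mult_le t2(4,5) C(1)) simp
  have b2: "wnorm e (snd q) (snd be) (\<lambda>z. indicator Z z * ennreal (\<kappa> * tb_rho e z powr snd a))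
      \<le> ennreal (C * x1 / y1) * wnorm e (snd p) (snd al) (\<lambda>u. indicator S u * ennreal (g u))"
    if "test e (snd a) (snd b) (snd c) S g Z \<kappa>" "wnorm e (snd p) (snd al) (\<lambda>u. indicator S u * ennreal (g u)) < top" for S g Z \<kappa>
    using C(2)[OF t1(1) that(1) _ that(2)] unfolding t1(2,3)
    by (intro ennreal_le_of_mult_le t1(4,5) C(1)) (simp add: mult.commute)
  have c1: "0 \<le> C * x2 / y2" "0 \<le> C * x1 / y1" using C t1 t2 by auto
  show ?thesis
    unfolding n_def using kernT1_necessary[OF p(1) q(1) c1(1) b1] kernT1_necessary[OF p(2) q(2) c1(2) b2] by blast
qed

section \<open>Comparison of S and T\<close>

lemma cmod_kernT: "cmod (kernT e a b c x y) = cmod (kernS e a b c x y)"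
  by (cases x; cases y)
     (simp add: kernT_def kernS_def norm_mult norm_divide norm_powr_real_powr' abs_mult)

lemma ennreal_cmod_kernS:
  "ennreal (cmod (kernS e a b c x y))
     = kern1 e (fst a) (fst b) (fst c) (fst x) (fst y) * kern1 e (snd a) (snd b) (snd c) (snd x) (snd y)"
  by (cases x; cases y)
     (simp add: kernS_def kern1_def norm_mult norm_divide abs_mult powr_minus_divide ennreal_mult[symmetric] mult_ac)

lemma kernS_nonneg: "kernS e a b c x y = of_real (cmod (kernS e a b c x y))"
  by (cases x; cases y) (simp add: kernS_def abs_mult norm_mult norm_divide)

lemma borel_measurable_kernS: "kernS e a b c x \<in> borel_measurable (lborel \<Otimes>\<^sub>M lborel)"
proof -
  obtain z w where x: "x = (z, w)" by force
  show ?thesis unfolding x kernS_def prod.case split_beta' by measurable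
qed

text \<open>Derived from continuity in each factor for fixed x. Continuity is available only on the
  domain, where the branch cut is avoided; hence the indicator.\<close>

lemma borel_measurable_kernT:
  assumes "x \<in> TB e \<times> TB e"
  shows "(\<lambda>y. indicator (TB e \<times> TB e) y *\<^sub>R kernT e a b c x y) \<in> borel_measurable (lborel \<Otimes>\<^sub>M lborel)"
proof -
  have m: "(\<lambda>u. indicator (TB e) u *\<^sub>R kernT1 e a b c z u) \<in> borel_measurable borel" if "z \<in> TB e" for a b c z
    using that by (intro borel_measurable_continuous_on_indicator continuous_on_kernT1) auto
  have [measurable]: "(\<lambda>u. indicator (TB e) u *\<^sub>R kernT1 e (fst a) (fst b) (fst c) (fst x) u) \<in> borel_measurable borel"
    "(\<lambda>u. indicator (TB e) u *\<^sub>R kernT1 e (snd a) (snd b) (snd c) (snd x) u) \<in> borel_measurable borel"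
    using assms by (auto intro!: m)
  have "(\<lambda>y. indicator (TB e \<times> TB e) y *\<^sub>R kernT e a b c x y)
    = (\<lambda>y. (indicator (TB e) (fst y) *\<^sub>R kernT1 e (fst a) (fst b) (fst c) (fst x) (fst y))
        * (indicator (TB e) (snd y) *\<^sub>R kernT1 e (snd a) (snd b) (snd c) (snd x) (snd y)))"
    by (auto simp: fun_eq_iff kernT_eq_mult indicator_times)
  also have "\<dots> \<in> borel_measurable (lborel \<Otimes>\<^sub>M lborel)" by measurable
  finally show ?thesis .
qed

text \<open>The operator S is applied to |f|, which has the same norm as f. The two integrands have
  equal modulus, so convergence carries over, and |T f| <= S |f| pointwise.\<close>

lemma bounded_kernT_if_bounded_kernS:
  fixes e :: "'n::finite"
  assumes "bounded_kop e (kernS e a b c) p al q be" and p: "0 < fst p" "0 < snd p" and q: "0 < fst q" "0 < snd q"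
  shows "bounded_kop e (kernT e a b c) p al q be"
proof -
  obtain C :: real where C: "\<And>f. f \<in> borel_measurable (lborel \<Otimes>\<^sub>M lborel) \<Longrightarrow> mixnorm e p al f < \<infinity> \<Longrightarrow>
      (AE x in lborel \<Otimes>\<^sub>M lborel. x \<in> TB e \<times> TB e \<longrightarrow>
            set_integrable (lborel \<Otimes>\<^sub>M lborel) (TB e \<times> TB e) (\<lambda>y. kernS e a b c x y * f y))
      \<and> mixnorm e q be (kop e (kernS e a b c) f) \<le> ennreal C * mixnorm e p al f"
    using assms unfolding bounded_kop_def by blast
  show ?thesis
    unfolding bounded_kop_def
  proof (intro exI[of _ C] allI impI)
    fix f :: "(complex^'n) \<times> (complex^'n) \<Rightarrow> complex"
    assume f [measurable]: "f \<in> borel_measurable (lborel \<Otimes>\<^sub>M lborel)" and fin: "mixnorm e p al f < \<infinity>"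
    define h where "h y = complex_of_real (cmod (f y))" for y
    have h [measurable]: "h \<in> borel_measurable (lborel \<Otimes>\<^sub>M lborel)" unfolding h_def by measurable
    have mh: "mixnorm e p al h = mixnorm e p al f" by (simp add: mixnorm_def h_def)
    have norm_eq: "cmod (indicator (TB e \<times> TB e) y *\<^sub>R (kernT e a b c x y * f y))
        = cmod (indicator (TB e \<times> TB e) y *\<^sub>R (kernS e a b c x y * h y))" for x y
      by (simp add: norm_mult cmod_kernT h_def)
    have int: "set_integrable (lborel \<Otimes>\<^sub>M lborel) (TB e \<times> TB e) (\<lambda>y. kernT e a b c x y * f y) \<longleftrightarrow>
        set_integrable (lborel \<Otimes>\<^sub>M lborel) (TB e \<times> TB e) (\<lambda>y. kernS e a b c x y * h y)" if x: "x \<in> TB e \<times> TB e" for x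
    proof -
      have [measurable]: "kernS e a b c x \<in> borel_measurable (lborel \<Otimes>\<^sub>M lborel)" by (rule borel_measurable_kernS)
      have TT: "TB e \<times> TB e \<in> sets (lborel \<Otimes>\<^sub>M lborel)" by (auto intro!: pair_measureI)
      have 1: "(\<lambda>y. indicator (TB e \<times> TB e) y *\<^sub>R (kernS e a b c x y * h y)) \<in> borel_measurable (lborel \<Otimes>\<^sub>M lborel)"
        using TT by measurable
      have "(\<lambda>y. (indicator (TB e \<times> TB e) y *\<^sub>R kernT e a b c x y) * f y) \<in> borel_measurable (lborel \<Otimes>\<^sub>M lborel)"
        using borel_measurable_kernT[OF x] f by (rule borel_measurable_times)
      then have 2: "(\<lambda>y. indicator (TB e \<times> TB e) y *\<^sub>R (kernT e a b c x y * f y)) \<in> borel_measurable (lborel \<Otimes>\<^sub>M lborel)"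
        by simp
      from 1 2 show ?thesis by (simp only: set_integrable_def integrable_iff_bounded norm_eq)
    qed
    note S = C[OF h, unfolded mh, OF fin]
    from S have "AE x in lborel \<Otimes>\<^sub>M lborel. x \<in> TB e \<times> TB e \<longrightarrow>
            set_integrable (lborel \<Otimes>\<^sub>M lborel) (TB e \<times> TB e) (\<lambda>y. kernS e a b c x y * h y)" by blast
    then have 1: "AE x in lborel \<Otimes>\<^sub>M lborel. x \<in> TB e \<times> TB e \<longrightarrow>
            set_integrable (lborel \<Otimes>\<^sub>M lborel) (TB e \<times> TB e) (\<lambda>y. kernT e a b c x y * f y)"
      by eventually_elim (use int in blast)
    have le: "cmod (kop e (kernT e a b c) f x) \<le> cmod (kop e (kernS e a b c) h x)" if x: "x \<in> TB e \<times> TB e" for x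
    proof (cases "set_integrable (lborel \<Otimes>\<^sub>M lborel) (TB e \<times> TB e) (\<lambda>y. kernT e a b c x y * f y)")
      case True
      have real: "indicator (TB e \<times> TB e) y *\<^sub>R (kernS e a b c x y * h y)
          = of_real (cmod (indicator (TB e \<times> TB e) y *\<^sub>R (kernT e a b c x y * f y)))" for y
        unfolding norm_eq by (subst kernS_nonneg) (simp add: h_def norm_mult scaleR_conv_of_real)
      have "cmod (kop e (kernT e a b c) f x)
          \<le> (LINT y|(lborel \<Otimes>\<^sub>M lborel). cmod (indicator (TB e \<times> TB e) y *\<^sub>R (kernT e a b c x y * f y)))"
        unfolding kop_def set_lebesgue_integral_def by (rule integral_norm_bound)
      also have "\<dots> \<le> cmod (kop e (kernS e a b c) h x)"
        unfolding kop_def set_lebesgue_integral_def real integral_complex_of_real by simp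
      finally show ?thesis .
    next
      case False
      \<comment> \<open>A Bochner integral that does not converge has the value 0.\<close>
      then show ?thesis by (simp add: kop_def set_lebesgue_integral_def set_integrable_def not_integrable_integral_eq)
    qed
    have "mixnorm e q be (kop e (kernT e a b c) f) \<le> mixnorm e q be (kop e (kernS e a b c) h)"
      unfolding mixnorm_eq_wnorm[OF q] using q le by (intro wnorm_mono ennreal_leI) auto
    also have "\<dots> \<le> ennreal C * mixnorm e p al f" using S by blast
    finally show "(AE x in lborel \<Otimes>\<^sub>M lborel. x \<in> TB e \<times> TB e \<longrightarrow>
            set_integrable (lborel \<Otimes>\<^sub>M lborel) (TB e \<times> TB e) (\<lambda>y. kernT e a b c x y * f y))
        \<and> mixnorm e q be (kop e (kernT e a b c) f) \<le> ennreal C * mixnorm e p al f" using 1 by blast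
  qed
qed

lemma bounded_kernS_if:
  fixes e :: "'n::finite"
  defines "n \<equiv> real CARD('n)"
  assumes p: "1 < fst p" "1 < snd p" and pq: "fst p \<le> fst q" "snd p \<le> snd q"
    and 1: "- fst q * fst a < fst be + 1" "fst al + 1 < fst p * (fst b + 1)"
      "fst c = n + 1 + fst a + fst b + ((n + 1 + fst be) / fst q - (n + 1 + fst al) / fst p)"
    and 2: "- snd q * snd a < snd be + 1" "snd al + 1 < snd p * (snd b + 1)"
      "snd c = n + 1 + snd a + snd b + ((n + 1 + snd be) / snd q - (n + 1 + snd al) / snd p)"
  shows "bounded_kop e (kernS e a b c) p al q be"
proof -
  obtain C1 where C1: "0 \<le> C1" "\<And>f. f \<in> borel_measurable borel \<Longrightarrow>
      wnorm e (fst q) (fst be) (kint e (kern1 e (fst a) (fst b) (fst c)) f) \<le> ennreal C1 * wnorm e (fst p) (fst al) f"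
    using kern1_bounded[OF p(1) pq(1) 1[unfolded n_def], of e] by blast
  obtain C2 where C2: "0 \<le> C2" "\<And>f. f \<in> borel_measurable borel \<Longrightarrow>
      wnorm e (snd q) (snd be) (kint e (kern1 e (snd a) (snd b) (snd c)) f) \<le> ennreal C2 * wnorm e (snd p) (snd al) f"
    using kern1_bounded[OF p(2) pq(2) 2[unfolded n_def], of e] by blast
  show ?thesis
  proof (rule bounded_kop_of_kern1_bounded[OF _ ennreal_cmod_kernS _ _ _ _ C1(1) C2(1) C1(2) C2(2)])
    fix x :: "(complex^'n) \<times> (complex^'n)"
    have [measurable]: "TB e \<times> TB e \<in> sets (lborel \<Otimes>\<^sub>M lborel)" by (auto intro!: pair_measureI)
    have [measurable]: "kernS e a b c x \<in> borel_measurable (lborel \<Otimes>\<^sub>M lborel)" by (rule borel_measurable_kernS)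
    show "(\<lambda>y. indicator (TB e \<times> TB e) y *\<^sub>R kernS e a b c x y) \<in> borel_measurable (lborel \<Otimes>\<^sub>M lborel)"
      by measurable
  qed (use p pq in auto)
qed

theorem theorem6p1:
  fixes e :: "'n::finite"
    and p q a b c al be :: "real \<times> real"
  defines "n \<equiv> real CARD('n)"
  assumes "1 < min (fst p) (snd p)"
    and "max (fst p) (snd p) \<le> min (fst q) (snd q)"
    and "fst al > -1" "snd al > -1" "fst be > -1" "snd be > -1"
  shows "(bounded_kop e (kernS e a b c) p al q be \<longleftrightarrow> bounded_kop e (kernT e a b c) p al q be)
       \<and> (bounded_kop e (kernT e a b c) p al q be \<longleftrightarrow>
          (- fst q * fst a < fst be + 1 \<and> fst al + 1 < fst p * (fst b + 1)
             \<and> fst c = n + 1 + fst a + fst b + ((n + 1 + fst be) / fst q - (n + 1 + fst al) / fst p))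
        \<and> (- snd q * snd a < snd be + 1 \<and> snd al + 1 < snd p * (snd b + 1)
             \<and> snd c = n + 1 + snd a + snd b + ((n + 1 + snd be) / snd q - (n + 1 + snd al) / snd p)))"
    (is "(?S \<longleftrightarrow> ?T) \<and> (?T \<longleftrightarrow> ?C)")
proof -
  have p: "1 < fst p" "1 < snd p" and pq: "fst p \<le> fst q" "snd p \<le> snd q"
    using assms by auto
  then have pos: "0 < fst p" "0 < snd p" "0 < fst q" "0 < snd q" by auto
  \<comment> \<open>The implications form a cycle; the passage from the oscillating T back to the
    positive S goes through the conditions on the exponents.\<close>
  have "?S \<Longrightarrow> ?T" by (rule bounded_kernT_if_bounded_kernS[OF _ pos])
  moreover have "?T \<Longrightarrow> ?C" unfolding n_def by (rule bounded_kernT_imp[OF _ p pos(3,4)])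
  moreover have "?C \<Longrightarrow> ?S" unfolding n_def using p pq by (intro bounded_kernS_if) auto
  ultimately show ?thesis by blast
qed

end
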